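(* For the faithful functor $\mathcal O_{\mathcal M}:\mathbf{MT}\to\mathbf{Frm}$, the spectra of fiber-terminal objects coincide with the $T_D$-spaces: a topological space $X$ is $T_D$ if and only if it is homeomorphic to $\mathsf{pt}_{\mathcal M}(L,M)$ for some fiber-terminal MT-algebra $(L,M)$.
   Context: An MT-algebra is a pair $(L,M)$ with $M$ a complete Boolean algebra and $L\subseteq M$ a subframe (whose elements are called open). All MT-algebras are assumed $T_0$: every element of $M$ is a join of elements of the form $\bigwedge_ia_i\wedge\neg a$ with $a,a_i\in L$. $\mathbf{MT}$ is the category whose objects are ($T_0$) MT-algebras and whose morphisms $(L,M)\to(L',M')$ are homomorphisms of complete Boolean algebras $M\to M'$ mapping $L$ into $L'$. $\mathcal O_{\mathcal M}:\mathbf{MT}\to\mathbf{Frm}$ sends $(L,M)$ to $L$ and a morphism to its restriction; it is faithful. $\mathsf{pt}_{\mathcal M}(L,M)$, the spectrum of $(L,M)$, is the set of morphisms $(L,M)\to(\mathbf 2,\mathbf 2)$ in $\mathbf{MT}$ ($\mathbf 2=\{0<1\}$), equivalently the set of atoms of $M$, with opens $\{f\mid f(a)=1\}$ for $a\in L$ (equivalently $\{x\text{ atom}\mid x\le a\}$). The fiber $\mathcal O_{\mathcal M}^{-1}(N)$ at a frame $N$ is the preorder of pairs $(C,\theta^C)$ with $C\in\mathbf{MT}$ and $\theta^C:\mathcal O_{\mathcal M}(C)\to N$ an isomorphism, with $(C,\theta^C)\le(D,\theta^D)$ iff there is $p:C\to D$ in $\mathbf{MT}$ with $\theta^D\circ\mathcal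 O_{\mathcal M}(p)=\theta^C$. $C$ is fiber-terminal if $(C,\mathrm{id})$ is a top element of $\mathcal O_{\mathcal M}^{-1}(\mathcal O_{\mathcal M}(C))$. A space is $T_D$ if every point is the intersection of an open and a closed set. *)

theory Defs
  imports "HOL-Algebra.Complete_Lattice" "HOL-Analysis.Abstract_Topology"
begin

section \<open>MT-algebras\<close>

text \<open>Structures are carrier-based, so that one type supports many of them; the operations
  are the ones \<^theory>\<open>HOL-Algebra.Complete_Lattice\<close> derives from the order.\<close>

locale complete_boolean_lattice = complete_lattice L for L (structure) +
  assumes meet_join_distrib:
      "\<lbrakk>x \<in> carrier L; y \<in> carrier L; z \<in> carrier L\<rbrakk> \<Longrightarrow> x \<sqinter> (y \<squnion> z) = (x \<sqinter> y) \<squnion> (x \<sqinter> z)"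
    and complement_exists:
      "x \<in> carrier L \<Longrightarrow> \<exists>y\<in>carrier L. x \<squnion> y = \<top> \<and> x \<sqinter> y = \<bottom>"

definition compl :: "('a, 'm) gorder_scheme \<Rightarrow> 'a \<Rightarrow> 'a"
  where "compl L x =
    (THE y. y \<in> carrier L \<and> x \<squnion>\<^bsub>L\<^esub> y = \<top>\<^bsub>L\<^esub> \<and> x \<sqinter>\<^bsub>L\<^esub> y = \<bottom>\<^bsub>L\<^esub>)"

record 'a mt = "'a gorder" +
  opens :: "'a set"

definition subframe :: "'a set \<Rightarrow> ('a, 'm) gorder_scheme \<Rightarrow> bool"
  where "subframe F L \<longleftrightarrow> F \<subseteq> carrier L \<and> \<top>\<^bsub>L\<^esub> \<in> F \<and>
    (\<forall>a\<in>F. \<forall>b\<in>F. a \<sqinter>\<^bsub>L\<^esub> b \<in> F) \<and> (\<forall>S\<subseteq>F. \<Squnion>\<^bsub>L\<^esub>S \<in> F)"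

definition basic_elements :: "'a mt \<Rightarrow> 'a set"
  where "basic_elements A =
    {(\<Sqinter>\<^bsub>A\<^esub>S) \<sqinter>\<^bsub>A\<^esub> compl A a | S a. S \<subseteq> opens A \<and> a \<in> opens A}"

text \<open>All MT-algebras are \<open>T\<^sub>0\<close>. The one-element algebra (the algebra of the empty space) is
  not excluded.\<close>

locale mt_algebra = complete_boolean_lattice A for A :: "'a mt" (structure) +
  assumes opens_subframe: "subframe (opens A) A"
    and T0: "x \<in> carrier A \<Longrightarrow> \<exists>B \<subseteq> basic_elements A. x = \<Squnion>B"

text \<open>Extensionality makes morphisms equal as HOL functions iff they agree on the carrier, so
  that the points of a spectrum are not duplicated.\<close>

definition mt_hom :: "'a mt \<Rightarrow> 'b mt \<Rightarrow> ('a \<Rightarrow> 'b) set"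
  where "mt_hom A B = {f \<in> carrier A \<rightarrow>\<^sub>E carrier B.
    sup_pres A B f \<and> inf_pres A B f \<and>
    (\<forall>x\<in>carrier A. f (compl A x) = compl B (f x)) \<and>
    f ` opens A \<subseteq> opens B}"


section \<open>Spectra\<close>

definition mt_two :: "bool mt"
  where "mt_two = \<lparr>carrier = UNIV, eq = (=), le = (\<le>), opens = UNIV\<rparr>"

definition points :: "'a mt \<Rightarrow> ('a \<Rightarrow> bool) set"
  where "points A = mt_hom A mt_two"

definition spectrum :: "'a mt \<Rightarrow> ('a \<Rightarrow> bool) topology"
  where "spectrum A = topology (\<lambda>U. \<exists>a\<in>opens A. U = {f \<in> points A. f a})"


section \<open>Fibers of the functor of opens\<close>

definition open_frame :: "'a mt \<Rightarrow> 'a gorder"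
  where "open_frame A = \<lparr>carrier = opens A, eq = (=), le = le A\<rparr>"

definition frame_hom :: "'a gorder \<Rightarrow> 'b gorder \<Rightarrow> ('a \<Rightarrow> 'b) set"
  where "frame_hom F G = {f \<in> carrier F \<rightarrow> carrier G.
    f \<top>\<^bsub>F\<^esub> = \<top>\<^bsub>G\<^esub> \<and>
    (\<forall>x\<in>carrier F. \<forall>y\<in>carrier F. f (x \<sqinter>\<^bsub>F\<^esub> y) = f x \<sqinter>\<^bsub>G\<^esub> f y) \<and>
    (\<forall>S\<subseteq>carrier F. f (\<Squnion>\<^bsub>F\<^esub>S) = \<Squnion>\<^bsub>G\<^esub>(f ` S))}"

definition frame_iso :: "'a gorder \<Rightarrow> 'b gorder \<Rightarrow> ('a \<Rightarrow> 'b) set"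
  where "frame_iso F G = {f \<in> frame_hom F G. bij_betw f (carrier F) (carrier G)}"

definition fiber :: "'n gorder \<Rightarrow> ('a mt \<times> ('a \<Rightarrow> 'n)) set"
  where "fiber N = {(C, \<theta>). mt_algebra C \<and> \<theta> \<in> frame_iso (open_frame C) N}"

definition fiber_le :: "'a mt \<times> ('a \<Rightarrow> 'n) \<Rightarrow> 'b mt \<times> ('b \<Rightarrow> 'n) \<Rightarrow> bool"
  where "fiber_le = (\<lambda>(C, \<theta>C) (D, \<theta>D). \<exists>p\<in>mt_hom C D. \<forall>a\<in>opens C. \<theta>D (p a) = \<theta>C a)"

text \<open>By \<open>T\<^sub>0\<close>, an element of an algebra over the opens of \<open>A\<close> is determined by the set
  of pairs \<open>(S, a)\<close>, with \<open>S\<close> a set of opens and \<open>a\<close> an open, whose basic element lies below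
  it. Hence the type \<open>('a set \<times> 'a) set\<close> carries a copy of every member of the fiber, and
  quantifying over the members living on it is no restriction: see \<open>fiber_terminal_universal\<close>
  below.\<close>

definition fiber_terminal :: "'a mt \<Rightarrow> bool"
  where "fiber_terminal A \<longleftrightarrow> mt_algebra A \<and>
    (\<forall>C \<in> (fiber (open_frame A) :: (('a set \<times> 'a) set mt \<times> _) set). fiber_le C (A, id))"


section \<open>\<open>T\<^sub>D\<close>-spaces\<close>

definition TD_space :: "'a topology \<Rightarrow> bool"
  where "TD_space X \<longleftrightarrow>
    (\<forall>x\<in>topspace X. \<exists>U C. openin X U \<and> closedin X C \<and> {x} = U \<inter> C)"


section \<open>Transport along injections\<close>

definition transport :: "('a \<Rightarrow> 'b) \<Rightarrow> ('a, 'm) gorder_scheme \<Rightarrow> ('b, 'n) gorder_scheme \<Rightarrow> bool"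
  where "transport e L K \<longleftrightarrow> partial_order L \<and> inj_on e (carrier L) \<and> carrier K = e ` carrier L \<and>
    eq K = (=) \<and> (\<forall>x\<in>carrier L. \<forall>y\<in>carrier L. le K (e x) (e y) \<longleftrightarrow> le L x y)"

lemma Collect_Int_image:
  assumes "\<And>u. u \<in> C \<Longrightarrow> Q (e u) \<longleftrightarrow> P u"
  shows "{v. Q v} \<inter> e ` C = e ` ({u. P u} \<inter> C)"
  using assms by blast

lemma partial_order_lub_eq:
  assumes "partial_order L" "is_lub L s A" shows "\<Squnion>\<^bsub>L\<^esub>A = s"
  unfolding sup_def
  by (rule some_equality[where P="\<lambda>s. is_lub L s A"]) (use assms partial_order.least_unique in metis)+

lemma partial_order_glb_eq:
  assumes "partial_order L" "is_glb L s A" shows "\<Sqinter>\<^bsub>L\<^esub>A = s"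
  unfolding inf_def
  by (rule some_equality[where P="\<lambda>s. is_glb L s A"]) (use assms partial_order.greatest_unique in metis)+

lemma partial_order_top_eq:
  assumes "partial_order L" "greatest L s (carrier L)" shows "\<top>\<^bsub>L\<^esub> = s"
  unfolding top_def
  by (rule some_equality) (use assms partial_order.greatest_unique in metis)+

lemma partial_order_bottom_eq:
  assumes "partial_order L" "least L s (carrier L)" shows "\<bottom>\<^bsub>L\<^esub> = s"
  unfolding bottom_def
  by (rule some_equality) (use assms partial_order.least_unique in metis)+

context
  fixes e L K
  assumes tr: "transport e L K"
begin

lemma transport_partial_order: "partial_order K"
proof -
  interpret L: partial_order L using tr by (simp add: transport_def)
  have c: "carrier K = e ` carrier L" and q: "eq K = (=)"
    and l: "\<And>x y. x \<in> carrier L \<Longrightarrow> y \<in> carrier L \<Longrightarrow> le K (e x) (e y) \<longleftrightarrow> le L x y"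
    using tr by (auto simp: transport_def)
  show ?thesis
  proof unfold_locales
    fix x y z
    assume le: "le K x y" "le K y z" and "x \<in> carrier K" "y \<in> carrier K" "z \<in> carrier K"
    then obtain u v w where u: "u \<in> carrier L" "x = e u" and v: "v \<in> carrier L" "y = e v"
      and w: "w \<in> carrier L" "z = e w" unfolding c by blast
    have "le L u v" "le L v w" using le u v w l by simp_all
    then have "le L u w" using L.le_trans u v w by blast
    then show "le K x z" using u w l by simp
  next
    fix x y
    assume le: "le K x y" "le K y x" and "x \<in> carrier K" "y \<in> carrier K"
    then obtain u v where u: "u \<in> carrier L" "x = e u" and v: "v \<in> carrier L" "y = e v"
      unfolding c by blast
    have "le L u v" "le L v u" using le u v l by simp_all
    then have "u = v" using L.le_antisym u v by blast
    then show "eq K x y" using u v q by simp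
  next
    fix x assume "x \<in> carrier K"
    then show "le K x x" using c l by auto
  qed (simp_all add: q)
qed

lemma transport_source: "partial_order L"
  using tr by (simp add: transport_def)

lemma transport_carrier: "carrier K = e ` carrier L"
  using tr by (simp add: transport_def)

lemma transport_Upper:
  assumes S: "S \<subseteq> carrier L" shows "Upper K (e ` S) = e ` Upper L S"
proof -
  have c: "carrier K = e ` carrier L"
    and l: "\<And>x y. x \<in> carrier L \<Longrightarrow> y \<in> carrier L \<Longrightarrow> le K (e x) (e y) \<longleftrightarrow> le L x y"
    using tr by (auto simp: transport_def)
  have "e ` S \<inter> e ` carrier L = e ` S" "S \<inter> carrier L = S" using S by auto
  moreover have "(\<forall>x. x \<in> e ` S \<longrightarrow> le K x (e u)) \<longleftrightarrow> (\<forall>x. x \<in> S \<longrightarrow> le L x u)"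
    if "u \<in> carrier L" for u
  proof -
    have "(\<forall>x. x \<in> e ` S \<longrightarrow> le K x (e u)) \<longleftrightarrow> (\<forall>x\<in>S. le K (e x) (e u))" by blast
    also have "\<dots> \<longleftrightarrow> (\<forall>x\<in>S. le L x u)" using S that l by (intro ball_cong) auto
    finally show ?thesis by blast
  qed
  ultimately show ?thesis unfolding Upper_def c
    by (intro Collect_Int_image) (simp add: Int_def[symmetric] flip: Int_iff)
qed

lemma transport_Lower:
  assumes S: "S \<subseteq> carrier L" shows "Lower K (e ` S) = e ` Lower L S"
proof -
  have c: "carrier K = e ` carrier L"
    and l: "\<And>x y. x \<in> carrier L \<Longrightarrow> y \<in> carrier L \<Longrightarrow> le K (e x) (e y) \<longleftrightarrow> le L x y"
    using tr by (auto simp: transport_def)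
  have "e ` S \<inter> e ` carrier L = e ` S" "S \<inter> carrier L = S" using S by auto
  moreover have "(\<forall>x. x \<in> e ` S \<longrightarrow> le K (e u) x) \<longleftrightarrow> (\<forall>x. x \<in> S \<longrightarrow> le L u x)"
    if "u \<in> carrier L" for u
  proof -
    have "(\<forall>x. x \<in> e ` S \<longrightarrow> le K (e u) x) \<longleftrightarrow> (\<forall>x\<in>S. le K (e u) (e x))" by blast
    also have "\<dots> \<longleftrightarrow> (\<forall>x\<in>S. le L u x)" using S that l by (intro ball_cong) auto
    finally show ?thesis by blast
  qed
  ultimately show ?thesis unfolding Lower_def c
    by (intro Collect_Int_image) (simp add: Int_def[symmetric] flip: Int_iff)
qed

lemma transport_least: "least L x T \<Longrightarrow> least K (e x) (e ` T)"
  using tr unfolding least_def transport_def by (auto simp: subset_iff)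

lemma transport_greatest: "greatest L x T \<Longrightarrow> greatest K (e x) (e ` T)"
  using tr unfolding greatest_def transport_def by (auto simp: subset_iff)

lemma transport_lub:
  assumes "is_lub L s S" "S \<subseteq> carrier L" shows "is_lub K (e s) (e ` S)"
  using transport_least[OF assms(1)] transport_Upper[OF assms(2)] by simp

lemma transport_glb:
  assumes "is_glb L s S" "S \<subseteq> carrier L" shows "is_glb K (e s) (e ` S)"
  using transport_greatest[OF assms(1)] transport_Lower[OF assms(2)] by simp

lemma transport_sup:
  assumes "is_lub L s S" "S \<subseteq> carrier L" shows "\<Squnion>\<^bsub>K\<^esub>(e ` S) = e (\<Squnion>\<^bsub>L\<^esub>S)"
  using partial_order_lub_eq[OF transport_partial_order transport_lub[OF assms]]
    partial_order_lub_eq[OF transport_source assms(1)] by simp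

lemma transport_inf:
  assumes "is_glb L s S" "S \<subseteq> carrier L" shows "\<Sqinter>\<^bsub>K\<^esub>(e ` S) = e (\<Sqinter>\<^bsub>L\<^esub>S)"
  using partial_order_glb_eq[OF transport_partial_order transport_glb[OF assms]]
    partial_order_glb_eq[OF transport_source assms(1)] by simp

lemma transport_top:
  assumes "greatest L s (carrier L)" shows "\<top>\<^bsub>K\<^esub> = e \<top>\<^bsub>L\<^esub>"
  using partial_order_top_eq[OF transport_partial_order] transport_greatest[OF assms]
    partial_order_top_eq[OF transport_source assms] transport_carrier by simp

lemma transport_bottom:
  assumes "least L s (carrier L)" shows "\<bottom>\<^bsub>K\<^esub> = e \<bottom>\<^bsub>L\<^esub>"
  using partial_order_bottom_eq[OF transport_partial_order] transport_least[OF assms]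
    partial_order_bottom_eq[OF transport_source assms] transport_carrier by simp

end

context complete_lattice
begin

lemma sup_is_lub: "S \<subseteq> carrier L \<Longrightarrow> is_lub L (\<Squnion>S) S"
  using sup_exists[of S] partial_order_lub_eq[OF partial_order_axioms, of _ S] by fastforce

lemma inf_is_glb: "S \<subseteq> carrier L \<Longrightarrow> is_glb L (\<Sqinter>S) S"
  using inf_exists[of S] partial_order_glb_eq[OF partial_order_axioms, of _ S] by fastforce

context
  fixes e and K :: "('k, 'n) gorder_scheme"
  assumes tr: "transport e L K"
begin

lemma transport_complete_lattice: "complete_lattice K"
proof -
  interpret K: partial_order K by (rule transport_partial_order[OF tr])
  have c: "carrier K = e ` carrier L" using tr by (auto simp: transport_def)
  show ?thesis
  proof unfold_locales
    fix A assume "A \<subseteq> carrier K"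
    then obtain S where "S \<subseteq> carrier L" "A = e ` S" unfolding c by (metis subset_image_iff)
    then show "\<exists>s. is_lub K s A" "\<exists>s. is_glb K s A"
      using transport_lub[OF tr sup_is_lub, of S] transport_glb[OF tr inf_is_glb, of S] by auto
  qed
qed

lemma transport_Sup: "S \<subseteq> carrier L \<Longrightarrow> \<Squnion>\<^bsub>K\<^esub>(e ` S) = e (\<Squnion>S)"
  by (rule transport_sup[OF tr sup_is_lub])

lemma transport_Inf: "S \<subseteq> carrier L \<Longrightarrow> \<Sqinter>\<^bsub>K\<^esub>(e ` S) = e (\<Sqinter>S)"
  by (rule transport_inf[OF tr inf_is_glb])

lemma transport_join: "x \<in> carrier L \<Longrightarrow> y \<in> carrier L \<Longrightarrow> e x \<squnion>\<^bsub>K\<^esub> e y = e (x \<squnion> y)"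
  using transport_Sup[of "{x, y}"] by (simp add: join_def)

lemma transport_meet: "x \<in> carrier L \<Longrightarrow> y \<in> carrier L \<Longrightarrow> e x \<sqinter>\<^bsub>K\<^esub> e y = e (x \<sqinter> y)"
  using transport_Inf[of "{x, y}"] by (simp add: meet_def)

lemma transport_Top: "\<top>\<^bsub>K\<^esub> = e \<top>"
  by (rule transport_top[OF tr top_greatest])

lemma transport_Bottom: "\<bottom>\<^bsub>K\<^esub> = e \<bottom>"
  by (rule transport_bottom[OF tr bottom_least])

end
end

context complete_boolean_lattice
begin

lemma complement_unique:
  assumes x: "x \<in> carrier L" and y: "y \<in> carrier L" "x \<squnion> y = \<top>" "x \<sqinter> y = \<bottom>"
    and z: "z \<in> carrier L" "x \<squnion> z = \<top>" "x \<sqinter> z = \<bottom>"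
  shows "y = z"
proof -
  have *: "le L a b" if a: "a \<in> carrier L" "x \<sqinter> a = \<bottom>" and b: "b \<in> carrier L" "x \<squnion> b = \<top>" for a b
  proof -
    have "a = a \<sqinter> (x \<squnion> b)"
      unfolding b(2) using a by (intro le_antisym meet_le meet_left meet_closed) auto
    also have "\<dots> = (a \<sqinter> x) \<squnion> (a \<sqinter> b)" using a b x meet_join_distrib by blast
    also have "\<dots> = \<bottom> \<squnion> (a \<sqinter> b)" using meet_comm[where x=a and y=x and L=L] a by simp
    also have "\<dots> = a \<sqinter> b"
      using a b by (intro le_antisym join_le join_right join_closed meet_closed bottom_lower) auto
    finally show ?thesis using meet_right[of a b] a b by simp
  qed
  show ?thesis using *[of y z] *[of z y] y z le_antisym by blast
qed

lemma compl_eq: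
  assumes "x \<in> carrier L" "y \<in> carrier L" "x \<squnion> y = \<top>" "x \<sqinter> y = \<bottom>"
  shows "compl L x = y"
  unfolding compl_def
  by (rule the_equality) (use assms complement_unique in blast)+

lemma compl_props:
  assumes "x \<in> carrier L"
  shows "compl L x \<in> carrier L" "x \<squnion> compl L x = \<top>" "x \<sqinter> compl L x = \<bottom>"
  using complement_exists[OF assms] compl_eq[OF assms] by auto

context
  fixes e and K :: "('k, 'n) gorder_scheme"
  assumes tr: "transport e L K"
begin

lemma transport_complete_boolean_lattice: "complete_boolean_lattice K"
proof -
  interpret K: complete_lattice K by (rule transport_complete_lattice[OF tr])
  have c: "carrier K = e ` carrier L" using tr by (auto simp: transport_def)
  note s = transport_join[OF tr] transport_meet[OF tr] transport_Top[OF tr] transport_Bottom[OF tr]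
  show ?thesis
  proof (unfold_locales, unfold c)
    fix x y z assume "x \<in> e ` carrier L" "y \<in> e ` carrier L" "z \<in> e ` carrier L"
    then show "x \<sqinter>\<^bsub>K\<^esub> (y \<squnion>\<^bsub>K\<^esub> z) = x \<sqinter>\<^bsub>K\<^esub> y \<squnion>\<^bsub>K\<^esub> x \<sqinter>\<^bsub>K\<^esub> z"
      by (auto simp: s meet_join_distrib)
  next
    fix x assume "x \<in> e ` carrier L"
    then obtain u where u: "u \<in> carrier L" "x = e u" by auto
    obtain v where "v \<in> carrier L" "u \<squnion> v = \<top>" "u \<sqinter> v = \<bottom>" using complement_exists u(1) by blast
    then show "\<exists>y\<in>e ` carrier L. x \<squnion>\<^bsub>K\<^esub> y = \<top>\<^bsub>K\<^esub> \<and> x \<sqinter>\<^bsub>K\<^esub> y = \<bottom>\<^bsub>K\<^esub>"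
      using u by (intro bexI[of _ "e v"]) (simp_all add: s)
  qed
qed

lemma transport_compl: "x \<in> carrier L \<Longrightarrow> compl K (e x) = e (compl L x)"
proof -
  assume x: "x \<in> carrier L"
  interpret K: complete_boolean_lattice K by (rule transport_complete_boolean_lattice)
  note s = transport_join[OF tr] transport_meet[OF tr] transport_Top[OF tr] transport_Bottom[OF tr]
  have c: "carrier K = e ` carrier L" using tr by (auto simp: transport_def)
  show ?thesis
    by (rule K.compl_eq) (use x c compl_props[OF x] in \<open>auto simp: s\<close>)
qed

end
end

definition image_mt :: "('a \<Rightarrow> 'b) \<Rightarrow> 'a mt \<Rightarrow> 'b mt"
  where "image_mt e C = \<lparr>carrier = e ` carrier C, eq = (=),
    le = (\<lambda>u v. le C (inv_into (carrier C) e u) (inv_into (carrier C) e v)), opens = e ` opens C\<rparr>"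

context mt_algebra
begin

lemma opens_carrier: "opens A \<subseteq> carrier A"
  using opens_subframe by (simp add: subframe_def)

lemma basic_elements_carrier: "basic_elements A \<subseteq> carrier A"
proof -
  have "\<Sqinter>S \<sqinter> compl A a \<in> carrier A" if "S \<subseteq> opens A" "a \<in> opens A" for S a
    using that opens_carrier by (intro meet_closed inf_closed compl_props(1)) auto
  then show ?thesis by (auto simp: basic_elements_def)
qed

lemma open_frame_partial_order: "partial_order (open_frame A)"
proof unfold_locales
  fix x y z
  assume "le (open_frame A) x y" "le (open_frame A) y z"
    "x \<in> carrier (open_frame A)" "y \<in> carrier (open_frame A)" "z \<in> carrier (open_frame A)"
  then show "le (open_frame A) x z"
    using opens_carrier le_trans[of x y z] by (auto simp: open_frame_def)
next
  fix x y
  assume "le (open_frame A) x y" "le (open_frame A) y x"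
    "x \<in> carrier (open_frame A)" "y \<in> carrier (open_frame A)"
  then show "eq (open_frame A) x y"
    using opens_carrier le_antisym[of x y] by (auto simp: open_frame_def)
qed (use opens_carrier in \<open>auto simp: open_frame_def\<close>)

lemma open_frame_lub:
  assumes "S \<subseteq> opens A" shows "is_lub (open_frame A) (\<Squnion>S) S"
proof -
  have "S \<subseteq> carrier A" "\<Squnion>S \<in> opens A"
    using assms opens_subframe by (auto simp: subframe_def)
  moreover have "le A (\<Squnion>S) x" if "x \<in> opens A" "\<And>y. y \<in> S \<Longrightarrow> le A y x" for x
    using that opens_carrier calculation by (intro sup_least) auto
  moreover have "le A x (\<Squnion>S)" if "x \<in> S" for x
    using that calculation by (intro sup_upper) auto
  ultimately show ?thesis using assms
    by (auto simp: least_def Upper_def open_frame_def) blast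
qed

lemma open_frame_glb:
  assumes "a \<in> opens A" "b \<in> opens A" shows "is_glb (open_frame A) (a \<sqinter> b) {a, b}"
proof -
  have "a \<sqinter> b \<in> opens A" "a \<in> carrier A" "b \<in> carrier A"
    using assms opens_subframe by (auto simp: subframe_def)
  moreover have "le A x (a \<sqinter> b)" if "x \<in> opens A" "le A x a" "le A x b" for x
    using that opens_carrier calculation by (intro meet_le) auto
  moreover have "le A (a \<sqinter> b) a" "le A (a \<sqinter> b) b"
    using calculation by (intro meet_left meet_right; simp)+
  ultimately show ?thesis using assms
    by (auto simp: greatest_def Lower_def open_frame_def)
qed

lemma open_frame_top: "greatest (open_frame A) \<top> (opens A)"
proof -
  have "le A x \<top>" if "x \<in> opens A" for x
    using that opens_carrier by (intro top_higher) auto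
  then show ?thesis using opens_subframe
    by (auto simp: greatest_def open_frame_def subframe_def)
qed

context
  fixes e :: "'a \<Rightarrow> 'b"
  assumes inj: "inj_on e (carrier A)"
begin

lemma transport_image_mt: "transport e A (image_mt e A)"
  using inj partial_order_axioms by (auto simp: transport_def image_mt_def)

lemma image_mt_algebra: "mt_algebra (image_mt e A)" (is "mt_algebra ?K")
proof -
  note tr = transport_image_mt
  interpret K: complete_boolean_lattice ?K
    by (rule transport_complete_boolean_lattice[OF tr])
  have c: "carrier ?K = e ` carrier A" and o: "opens ?K = e ` opens A"
    by (auto simp: image_mt_def)
  note s = transport_meet[OF tr] transport_Top[OF tr] transport_compl[OF tr]
  have basic: "e ` basic_elements A \<subseteq> basic_elements ?K"
  proof
    fix x assume "x \<in> e ` basic_elements A"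
    then obtain S a where Sa: "S \<subseteq> opens A" "a \<in> opens A" "x = e ((\<Sqinter>S) \<sqinter> compl A a)"
      by (auto simp: basic_elements_def)
    have "S \<subseteq> carrier A" "a \<in> carrier A" using Sa opens_carrier by auto
    then have "x = (\<Sqinter>\<^bsub>?K\<^esub>(e ` S)) \<sqinter>\<^bsub>?K\<^esub> compl ?K (e a)"
      using Sa transport_Inf[OF tr] by (simp add: s compl_props)
    then show "x \<in> basic_elements ?K"
      unfolding basic_elements_def o using Sa by blast
  qed
  have bc: "basic_elements A \<subseteq> carrier A"
    by (rule basic_elements_carrier)
  show ?thesis
  proof (rule mt_algebra.intro[OF K.complete_boolean_lattice_axioms mt_algebra_axioms.intro])
    have "\<Squnion>\<^bsub>?K\<^esub>S \<in> e ` opens A" if S: "S \<subseteq> e ` opens A" for S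
    proof -
      obtain T where "T \<subseteq> opens A" "S = e ` T" using S by (rule subset_imageE)
      moreover have "\<Squnion>\<^bsub>?K\<^esub>(e ` T) = e (\<Squnion>T)"
        by (rule transport_Sup[OF tr]) (use \<open>T \<subseteq> opens A\<close> opens_carrier in blast)
      moreover have "\<Squnion>T \<in> opens A" using \<open>T \<subseteq> opens A\<close> opens_subframe by (simp add: subframe_def)
      ultimately show ?thesis by simp
    qed
    moreover have "e a \<sqinter>\<^bsub>?K\<^esub> e b \<in> e ` opens A" if "a \<in> opens A" "b \<in> opens A" for a b
    proof -
      have "e a \<sqinter>\<^bsub>?K\<^esub> e b = e (a \<sqinter> b)" by (rule s) (use that opens_carrier in blast)+
      moreover have "a \<sqinter> b \<in> opens A" using that opens_subframe by (simp add: subframe_def)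
      ultimately show ?thesis by simp
    qed
    moreover have "\<top> \<in> opens A" using opens_subframe by (simp add: subframe_def)
    moreover have "e ` opens A \<subseteq> e ` carrier A" using opens_carrier by blast
    ultimately show "subframe (opens ?K) ?K"
      unfolding subframe_def o c s(2) by blast
  next
    fix x assume "x \<in> carrier ?K"
    then obtain u where u: "u \<in> carrier A" "x = e u" unfolding c by auto
    obtain B where B: "B \<subseteq> basic_elements A" "u = \<Squnion>B" using T0 u(1) by blast
    then have "x = \<Squnion>\<^bsub>?K\<^esub>(e ` B)" using u bc transport_Sup[OF tr, of B] by auto
    moreover have "e ` B \<subseteq> basic_elements ?K" using B(1) basic by blast
    ultimately show "\<exists>B\<subseteq>basic_elements ?K. x = \<Squnion>\<^bsub>?K\<^esub>B" by (intro exI[of _ "e ` B"] conjI)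
  qed
qed

lemma transport_open_frame: "transport e (open_frame A) (open_frame (image_mt e A))"
proof -
  have i: "inv_into (carrier A) e (e x) = x" if "x \<in> opens A" for x
    using inj that opens_carrier by (intro inv_into_f_f) auto
  have "inj_on e (opens A)" using inj opens_carrier by (rule inj_on_subset)
  with open_frame_partial_order i show ?thesis
    by (simp add: transport_def image_mt_def open_frame_def)
qed

lemma image_mt_fiber:
  assumes "\<theta> \<in> frame_iso (open_frame A) N"
  shows "(image_mt e A, \<theta> \<circ> inv_into (carrier A) e) \<in> fiber N" (is "(?K, ?t) \<in> _")
proof -
  note tr = transport_open_frame
  have c: "carrier (open_frame A) = opens A" "carrier (open_frame ?K) = e ` opens A"
    by (auto simp: open_frame_def image_mt_def)
  have t: "?t (e x) = \<theta> x" if "x \<in> opens A" for x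
    using inj that opens_carrier by (simp add: subset_iff)
  have h: "\<theta> \<in> opens A \<rightarrow> carrier N" "\<theta> \<top>\<^bsub>open_frame A\<^esub> = \<top>\<^bsub>N\<^esub>"
    "\<And>x y. x \<in> opens A \<Longrightarrow> y \<in> opens A \<Longrightarrow> \<theta> (x \<sqinter>\<^bsub>open_frame A\<^esub> y) = \<theta> x \<sqinter>\<^bsub>N\<^esub> \<theta> y"
    "\<And>S. S \<subseteq> opens A \<Longrightarrow> \<theta> (\<Squnion>\<^bsub>open_frame A\<^esub>S) = \<Squnion>\<^bsub>N\<^esub>(\<theta> ` S)"
    and bij: "bij_betw \<theta> (opens A) (carrier N)"
    using assms by (auto simp: frame_iso_def frame_hom_def c)
  have closed: "\<top>\<^bsub>open_frame A\<^esub> \<in> opens A"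
    "\<And>x y. x \<in> opens A \<Longrightarrow> y \<in> opens A \<Longrightarrow> x \<sqinter>\<^bsub>open_frame A\<^esub> y \<in> opens A"
    "\<And>S. S \<subseteq> opens A \<Longrightarrow> \<Squnion>\<^bsub>open_frame A\<^esub>S \<in> opens A"
    using partial_order_top_eq[OF open_frame_partial_order] open_frame_top
      partial_order_glb_eq[OF open_frame_partial_order open_frame_glb]
      partial_order_lub_eq[OF open_frame_partial_order open_frame_lub] opens_subframe
    by (auto simp: c subframe_def meet_def)
  have "?t \<in> frame_hom (open_frame ?K) N"
    unfolding frame_hom_def c
  proof (intro CollectI conjI ballI allI impI)
    show "?t \<in> e ` opens A \<rightarrow> carrier N" using h(1) t by auto
    have "\<top>\<^bsub>open_frame ?K\<^esub> = e \<top>\<^bsub>open_frame A\<^esub>"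
      using transport_top[OF tr] open_frame_top c by metis
    then show "?t \<top>\<^bsub>open_frame ?K\<^esub> = \<top>\<^bsub>N\<^esub>" using t closed h by simp
  next
    fix x y assume "x \<in> e ` opens A" "y \<in> e ` opens A"
    then obtain a b where ab: "a \<in> opens A" "b \<in> opens A" "x = e a" "y = e b" by auto
    have "x \<sqinter>\<^bsub>open_frame ?K\<^esub> y = e (a \<sqinter>\<^bsub>open_frame A\<^esub> b)"
      using transport_inf[OF tr open_frame_glb] ab c by (simp add: meet_def)
    then show "?t (x \<sqinter>\<^bsub>open_frame ?K\<^esub> y) = ?t x \<sqinter>\<^bsub>N\<^esub> ?t y" using ab t closed h by simp
  next
    fix S assume "S \<subseteq> e ` opens A"
    then obtain T where T: "T \<subseteq> opens A" "S = e ` T" by (rule subset_imageE)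
    have "\<Squnion>\<^bsub>open_frame ?K\<^esub>S = e (\<Squnion>\<^bsub>open_frame A\<^esub>T)"
      using transport_sup[OF tr open_frame_lub] T c by simp
    moreover have "?t ` S = \<theta> ` T" using T t by (force simp: image_image)
    ultimately show "?t (\<Squnion>\<^bsub>open_frame ?K\<^esub>S) = \<Squnion>\<^bsub>N\<^esub>(?t ` S)" using T t closed h by simp
  qed
  moreover have "bij_betw ?t (e ` opens A) (carrier N)"
  proof -
    have "bij_betw (inv_into (carrier A) e) (e ` opens A) (opens A)"
      by (rule bij_betw_byWitness[where f'=e]) (use inj opens_carrier in \<open>auto simp: subset_iff\<close>)
    then show ?thesis using bij by (rule bij_betw_trans)
  qed
  ultimately show ?thesis
    using image_mt_algebra by (simp add: fiber_def frame_iso_def c)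
qed

lemma image_mt_hom:
  assumes p: "p \<in> mt_hom (image_mt e A) B"
  shows "restrict (p \<circ> e) (carrier A) \<in> mt_hom A B"
proof -
  note tr = transport_image_mt
  let ?K = "image_mt e A" and ?q = "restrict (p \<circ> e) (carrier A)"
  have c: "carrier ?K = e ` carrier A" and o: "opens ?K = e ` opens A"
    by (auto simp: image_mt_def)
  have h: "p \<in> carrier ?K \<rightarrow>\<^sub>E carrier B" "sup_pres ?K B p" "inf_pres ?K B p"
    "\<And>x. x \<in> carrier ?K \<Longrightarrow> p (compl ?K x) = compl B (p x)" "p ` opens ?K \<subseteq> opens B"
    using p by (auto simp: mt_hom_def)
  have im: "?q ` S = p ` e ` S" if "S \<subseteq> carrier A" for S
    using that by (force simp: image_image)
  have clo: "\<Squnion>S \<in> carrier A" "\<Sqinter>S \<in> carrier A" if "S \<subseteq> carrier A" for S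
    using that by auto
  show ?thesis
    unfolding mt_hom_def
  proof (intro CollectI conjI ballI)
    show "?q \<in> carrier A \<rightarrow>\<^sub>E carrier B" using h(1) c by auto
    show "sup_pres A B ?q"
      unfolding sup_pres_def
    proof (intro conjI allI impI)
      show "complete_lattice A" "complete_lattice B"
        using h(2) complete_lattice_axioms by (simp_all add: sup_pres_def)
      fix S assume S: "S \<subseteq> carrier A"
      then have "e ` S \<subseteq> carrier ?K" unfolding c by blast
      then have "p (\<Squnion>\<^bsub>?K\<^esub>(e ` S)) = \<Squnion>\<^bsub>B\<^esub>(p ` e ` S)"
        using h(2) unfolding sup_pres_def by blast
      then have "p (e (\<Squnion>S)) = \<Squnion>\<^bsub>B\<^esub>(p ` e ` S)"
        by (simp only: transport_Sup[OF tr S])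
      then show "?q (\<Squnion>S) = \<Squnion>\<^bsub>B\<^esub>(?q ` S)"
        unfolding im[OF S] using clo[OF S] by simp
    qed
    show "inf_pres A B ?q"
      unfolding inf_pres_def
    proof (intro conjI allI impI)
      show "complete_lattice A" "complete_lattice B"
        using h(3) complete_lattice_axioms by (simp_all add: inf_pres_def)
      fix S assume S: "S \<subseteq> carrier A"
      then have "e ` S \<subseteq> carrier ?K" unfolding c by blast
      then have "p (\<Sqinter>\<^bsub>?K\<^esub>(e ` S)) = \<Sqinter>\<^bsub>B\<^esub>(p ` e ` S)"
        using h(3) unfolding inf_pres_def by blast
      then have "p (e (\<Sqinter>S)) = \<Sqinter>\<^bsub>B\<^esub>(p ` e ` S)"
        by (simp only: transport_Inf[OF tr S])
      then show "?q (\<Sqinter>S) = \<Sqinter>\<^bsub>B\<^esub>(?q ` S)"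
        unfolding im[OF S] using clo[OF S] by simp
    qed
    show "?q (compl A x) = compl B (?q x)" if "x \<in> carrier A" for x
      using that h(4) c compl_props by (simp add: transport_compl[OF tr, symmetric])
    show "?q ` opens A \<subseteq> opens B" using h(5) im[OF opens_carrier] o by simp
  qed
qed

end
end


section \<open>Well-definedness\<close>

lemma mt_two_partial_order: "partial_order mt_two"
  by unfold_locales (auto simp: mt_two_def)

lemma mt_two_Sup: "is_lub mt_two (True \<in> S) S"
  by (auto simp: mt_two_def least_def Upper_def)

lemma mt_two_Inf: "is_glb mt_two (False \<notin> S) S"
  by (auto simp: mt_two_def greatest_def Lower_def) (metis (full_types))+

lemma mt_two_ops [simp]:
  "\<Squnion>\<^bsub>mt_two\<^esub>S \<longleftrightarrow> True \<in> S" "\<Sqinter>\<^bsub>mt_two\<^esub>S \<longleftrightarrow> False \<notin> S"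
  "x \<squnion>\<^bsub>mt_two\<^esub> y \<longleftrightarrow> x \<or> y" "x \<sqinter>\<^bsub>mt_two\<^esub> y \<longleftrightarrow> x \<and> y"
  "\<top>\<^bsub>mt_two\<^esub>" "\<not> \<bottom>\<^bsub>mt_two\<^esub>"
proof -
  show s: "\<Squnion>\<^bsub>mt_two\<^esub>S \<longleftrightarrow> True \<in> S" and i: "\<Sqinter>\<^bsub>mt_two\<^esub>S \<longleftrightarrow> False \<notin> S" for S
    using partial_order_lub_eq[OF mt_two_partial_order mt_two_Sup]
      partial_order_glb_eq[OF mt_two_partial_order mt_two_Inf] by simp_all
  show "x \<squnion>\<^bsub>mt_two\<^esub> y \<longleftrightarrow> x \<or> y" "x \<sqinter>\<^bsub>mt_two\<^esub> y \<longleftrightarrow> x \<and> y"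
    by (auto simp: join_def meet_def s i)
  have "greatest mt_two True (carrier mt_two)" "least mt_two False (carrier mt_two)"
    by (auto simp: mt_two_def greatest_def least_def)
  then show "\<top>\<^bsub>mt_two\<^esub>" "\<not> \<bottom>\<^bsub>mt_two\<^esub>"
    using partial_order_top_eq[OF mt_two_partial_order]
      partial_order_bottom_eq[OF mt_two_partial_order] by blast+
qed

lemma mt_two_algebra: "mt_algebra mt_two"
proof -
  interpret partial_order mt_two by (rule mt_two_partial_order)
  have c: "carrier mt_two = UNIV" "opens mt_two = UNIV" by (simp_all add: mt_two_def)
  interpret complete_lattice mt_two
    by unfold_locales (use mt_two_Sup mt_two_Inf in blast)+
  interpret complete_boolean_lattice mt_two
    by unfold_locales (auto simp: c)
  have "compl mt_two False" using compl_eq[of False True] by (simp add: c)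
  then have "True \<in> basic_elements mt_two"
    by (auto simp: basic_elements_def c intro!: exI[of _ "{}"] exI[of _ False])
  then have "\<exists>B\<subseteq>basic_elements mt_two. x = \<Squnion>\<^bsub>mt_two\<^esub>B" for x
    by (intro exI[of _ "if x then {True} else {}"]) auto
  then show ?thesis by unfold_locales (auto simp: subframe_def c)
qed

lemma openin_spectrum:
  assumes "mt_algebra A"
  shows "openin (spectrum A) U \<longleftrightarrow> (\<exists>a\<in>opens A. U = {f \<in> points A. f a})"
proof -
  interpret mt_algebra A by fact
  have Sup: "f (\<Squnion>\<^bsub>A\<^esub>S) \<longleftrightarrow> (\<exists>a\<in>S. f a)" if "f \<in> points A" "S \<subseteq> opens A" for f S
  proof -
    have "f (\<Squnion>\<^bsub>A\<^esub>S) = \<Squnion>\<^bsub>mt_two\<^esub>(f ` S)"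
      using that opens_carrier by (auto simp: points_def mt_hom_def sup_pres_def)
    then show ?thesis by auto
  qed
  have meet: "f (a \<sqinter>\<^bsub>A\<^esub> b) \<longleftrightarrow> f a \<and> f b" if "f \<in> points A" "a \<in> opens A" "b \<in> opens A" for f a b
  proof -
    have "{a, b} \<subseteq> carrier A" using that opens_carrier by auto
    then have "f (a \<sqinter>\<^bsub>A\<^esub> b) = \<Sqinter>\<^bsub>mt_two\<^esub>(f ` {a, b})"
      using that unfolding points_def mt_hom_def inf_pres_def meet_def by blast
    then show ?thesis by auto
  qed
  let ?O = "\<lambda>U. \<exists>a\<in>opens A. U = {f \<in> points A. f a}"
  have "istopology ?O"
    unfolding istopology_def
  proof (intro conjI allI impI)
    fix U V assume "?O U" "?O V"
    then obtain a b where ab: "a \<in> opens A" "b \<in> opens A" "U = {f \<in> points A. f a}" "V = {f \<in> points A. f b}"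
      by blast
    then have "U \<inter> V = {f \<in> points A. f (a \<sqinter>\<^bsub>A\<^esub> b)}" using meet by auto
    moreover have "a \<sqinter>\<^bsub>A\<^esub> b \<in> opens A" using ab opens_subframe by (simp add: subframe_def)
    ultimately show "?O (U \<inter> V)" by blast
  next
    fix \<U> assume U: "\<forall>U\<in>\<U>. ?O U"
    let ?S = "{a \<in> opens A. {f \<in> points A. f a} \<in> \<U>}"
    have "\<Union>\<U> = {f \<in> points A. \<exists>a\<in>?S. f a}" 
    proof (intro Set.set_eqI iffI)
      fix f assume "f \<in> \<Union>\<U>"
      then obtain V where V: "V \<in> \<U>" "f \<in> V" by blast
      then obtain a where "a \<in> opens A" "V = {f \<in> points A. f a}" using U by blast
      then show "f \<in> {f \<in> points A. \<exists>a\<in>?S. f a}" using V by blast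
    qed blast
    then have "\<Union>\<U> = {f \<in> points A. f (\<Squnion>\<^bsub>A\<^esub>?S)}" using Sup[of _ ?S] by auto
    moreover have "\<Squnion>\<^bsub>A\<^esub>?S \<in> opens A" using opens_subframe by (simp add: subframe_def)
    ultimately show "?O (\<Union>\<U>)" by blast
  qed
  then show ?thesis by (simp add: spectrum_def topology_inverse')
qed


text \<open>The quantification over one type in \<^const>\<open>fiber_terminal\<close> covers algebras of every
  type.\<close>

theorem fiber_terminal_universal:
  fixes A :: "'a mt" and C :: "'c mt"
  assumes "fiber_terminal A" and "(C, \<theta>) \<in> fiber (open_frame A)"
  shows "fiber_le (C, \<theta>) (A, id)"
proof -
  interpret C: mt_algebra C using assms(2) by (simp add: fiber_def)
  have th: "\<theta> \<in> frame_iso (open_frame C) (open_frame A)" using assms(2) by (simp add: fiber_def)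
  then have bij: "bij_betw \<theta> (opens C) (opens A)"
    by (simp add: frame_iso_def open_frame_def)
  let ?b = "\<lambda>S a. (\<Sqinter>\<^bsub>C\<^esub>S) \<sqinter>\<^bsub>C\<^esub> compl C a"
  define e where "e x = {(\<theta> ` S, \<theta> a) | S a. S \<subseteq> opens C \<and> a \<in> opens C \<and> le C (?b S a) x}" for x
  have sub: "le C x y" if x: "x \<in> carrier C" and y: "y \<in> carrier C" and xy: "e x \<subseteq> e y" for x y
  proof -
    obtain B where B: "B \<subseteq> basic_elements C" "x = \<Squnion>\<^bsub>C\<^esub>B" using C.T0 x by blast
    have bc: "basic_elements C \<subseteq> carrier C"
      by (rule C.basic_elements_carrier)
    have "le C z y" if z: "z \<in> B" for z
    proof -
      obtain S a where Sa: "S \<subseteq> opens C" "a \<in> opens C" "z = ?b S a"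
        using z B by (auto simp: basic_elements_def)
      have "le C z x" unfolding B(2) using z B bc by (intro C.sup_upper) auto
      then have "(\<theta> ` S, \<theta> a) \<in> e x" unfolding e_def Sa(3) using Sa(1,2) by blast
      then have "(\<theta> ` S, \<theta> a) \<in> e y" using xy by blast
      then obtain S' a' where S': "S' \<subseteq> opens C" "a' \<in> opens C" "le C (?b S' a') y"
        "\<theta> ` S = \<theta> ` S'" "\<theta> a = \<theta> a'" unfolding e_def by blast
      have "S = S'" "a = a'"
        using S' Sa bij by (auto simp: bij_betw_def inj_on_image_eq_iff inj_on_eq_iff)
      then show ?thesis using S' Sa by simp
    qed
    then show ?thesis unfolding B(2) using y B bc by (intro C.sup_least) auto
  qed
  have inj: "inj_on e (carrier C)"
    by (rule inj_onI) (use sub C.le_antisym in blast)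
  have "fiber_le (image_mt e C, \<theta> \<circ> inv_into (carrier C) e) (A, id)"
    using assms(1) C.image_mt_fiber[OF inj th] unfolding fiber_terminal_def by blast
  then obtain p where p: "p \<in> mt_hom (image_mt e C) A"
    and pe: "\<And>u. u \<in> e ` opens C \<Longrightarrow> p u = \<theta> (inv_into (carrier C) e u)"
    by (auto simp: fiber_le_def image_mt_def)
  have "restrict (p \<circ> e) (carrier C) a = \<theta> a" if "a \<in> opens C" for a
    using that pe[of "e a"] inj C.opens_carrier by (auto simp: subset_iff)
  then have "\<forall>a\<in>opens C. id (restrict (p \<circ> e) (carrier C) a) = \<theta> a" by simp
  then show ?thesis
    unfolding fiber_le_def prod.case by (rule bexI[OF _ C.image_mt_hom[OF inj p]])
qed

end

theory Submission
  imports Defs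
begin

text \<open>A morphism of MT-algebras out of \<open>C\<close> over a fixed frame of opens carries points back to
  points: each point of the target restricts to a point of \<open>C\<close> with the same values on opens.

  Let \<open>X\<close> be a \<open>T\<^sub>D\<close>-space and \<open>C\<close> an MT-algebra whose opens are identified with those of
  \<open>X\<close>. Write \<open>{x} = U - V\<close> with \<open>U\<close> and \<open>V\<close> open. That an open \<open>W\<close> contains \<open>x\<close> or not is
  expressed by \<open>U \<subseteq> V \<union> W\<close> or \<open>U \<inter> W \<subseteq> V\<close>, relations between opens that \<open>C\<close> also sees. So the
  nonzero element \<open>u \<sqinter> \<not> v\<close> of \<open>C\<close> splits no open, and as the opens generate \<open>C\<close> it is an
  atom (\<open>atom_point\<close>). These atoms, one for each \<open>x\<close>, assemble to a morphism from \<open>C\<close> to the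
  powerset algebra of \<open>X\<close> (\<open>mt_hom_into_powerset\<close>), which is therefore fiber-terminal; its
  spectrum is \<open>X\<close>.

  For the converse, let \<open>A\<close> be any MT-algebra. The locally closed elements \<open>a \<sqinter> \<not> b\<close>, with
  \<open>a\<close> and \<open>b\<close> open, form a meet-semilattice with zero. Its annihilator ideals form a complete
  Boolean algebra, in which the opens of \<open>A\<close> embed as a subframe, because finite meets distribute
  over joins in \<open>A\<close>; this is the idea of Funayama's theorem. In the resulting MT-algebra (the
  completion of \<open>A\<close>), unlike in a general one, every element is a join of locally closed ones.
  Consequently the least element on which a given point is true is locally closed
  (\<open>completion_point\<close>). If \<open>A\<close> is fiber-terminal, there is a morphism from the completion to \<open>A\<close>
  over the opens; along it a point \<open>f\<close> of \<open>A\<close> becomes a point of the completion concentrated on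
  some \<open>a \<sqinter> \<not> b\<close>. Any other point of \<open>A\<close> true on \<open>a\<close> and false on \<open>b\<close> restricts to the same
  point of the completion, so agrees with \<open>f\<close> on opens and equals \<open>f\<close>. Hence \<open>f\<close> is isolated in
  the spectrum by the open \<open>a\<close> and the complement of the open \<open>b\<close>.\<close>


section \<open>Complements in complete Boolean lattices\<close>

context complete_boolean_lattice
begin

lemma compl_compl:
  assumes "x \<in> carrier L" shows "compl L (compl L x) = x"
  using compl_props[OF assms] assms
  by (intro compl_eq) (simp_all add: join_comm[of L "compl L x"] meet_comm[of L "compl L x"])

lemma disjoint_iff_le_compl:
  assumes x: "x \<in> carrier L" and y: "y \<in> carrier L"
  shows "x \<sqinter> y = \<bottom> \<longleftrightarrow> x \<sqsubseteq> compl L y"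
proof
  note c = compl_props[OF y]
  assume xy: "x \<sqinter> y = \<bottom>"
  have "x = x \<sqinter> (y \<squnion> compl L y)"
    unfolding c(2) using x by (intro le_antisym meet_le meet_left meet_closed) auto
  also have "\<dots> = (x \<sqinter> y) \<squnion> (x \<sqinter> compl L y)" using x y c meet_join_distrib by blast
  also have "\<dots> \<sqsubseteq> compl L y"
    unfolding xy using x c by (intro join_le meet_right bottom_lower) auto
  finally show "x \<sqsubseteq> compl L y" .
next
  note c = compl_props[OF y]
  assume le: "x \<sqsubseteq> compl L y"
  have "x \<sqinter> y \<sqsubseteq> y \<sqinter> compl L y"
    using le x y c meet_left[of x y] meet_right[of x y]
    by (intro meet_le) (auto intro: le_trans)
  then show "x \<sqinter> y = \<bottom>" using x y c(3) by (simp add: le_antisym)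
qed

lemma le_iff_disjoint_compl:
  assumes "x \<in> carrier L" "y \<in> carrier L"
  shows "x \<sqsubseteq> y \<longleftrightarrow> x \<sqinter> compl L y = \<bottom>"
  using disjoint_iff_le_compl[of x "compl L y"] assms compl_props(1) compl_compl by simp

lemma disjoint_Sup_iff:
  assumes x: "x \<in> carrier L" and S: "S \<subseteq> carrier L"
  shows "x \<sqinter> \<Squnion>S = \<bottom> \<longleftrightarrow> (\<forall>s\<in>S. x \<sqinter> s = \<bottom>)"
proof -
  have sym: "x \<sqinter> y = \<bottom> \<longleftrightarrow> y \<sqsubseteq> compl L x" if "y \<in> carrier L" for y
    using disjoint_iff_le_compl[OF that x] meet_comm[where L=L and x=x and y=y] by simp
  have "\<Squnion>S \<sqsubseteq> compl L x" if "\<forall>s\<in>S. s \<sqsubseteq> compl L x"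
    using that S compl_props(1)[OF x] by (intro sup_least) auto
  moreover have "s \<sqsubseteq> compl L x" if "s \<in> S" "\<Squnion>S \<sqsubseteq> compl L x" for s
    using le_trans[OF sup_upper[OF S that(1)] that(2)] that S compl_props(1)[OF x] by auto
  ultimately have "\<Squnion>S \<sqsubseteq> compl L x \<longleftrightarrow> (\<forall>s\<in>S. s \<sqsubseteq> compl L x)" by blast
  then show ?thesis using sym S by (auto simp: subset_iff)
qed

lemma disjoint_join_iff:
  assumes "x \<in> carrier L" "y \<in> carrier L" "z \<in> carrier L"
  shows "x \<sqinter> (y \<squnion> z) = \<bottom> \<longleftrightarrow> x \<sqinter> y = \<bottom> \<and> x \<sqinter> z = \<bottom>"
  using disjoint_Sup_iff[of x "{y, z}"] assms by (simp add: join_def)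

lemma compl_join:
  assumes y: "y \<in> carrier L" and z: "z \<in> carrier L"
  shows "compl L (y \<squnion> z) = compl L y \<sqinter> compl L z"
proof -
  note c = compl_props(1)[OF y] compl_props(1)[OF z] compl_props(1)[OF join_closed[OF y z]]
  have *: "x \<sqsubseteq> compl L (y \<squnion> z) \<longleftrightarrow> x \<sqsubseteq> compl L y \<and> x \<sqsubseteq> compl L z" if "x \<in> carrier L" for x
    using that y z disjoint_join_iff disjoint_iff_le_compl join_closed by metis
  show ?thesis
    using *[of "compl L (y \<squnion> z)"] *[of "compl L y \<sqinter> compl L z"] c
    by (intro le_antisym meet_le) (auto intro: meet_left meet_right)
qed

lemma diff_le:
  assumes u: "u \<in> carrier L" and v: "v \<in> carrier L" and a: "a \<in> carrier L" and le: "u \<sqsubseteq> v \<squnion> a"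
  shows "u \<sqinter> compl L v \<sqsubseteq> a"
proof -
  note c = compl_props(1)[OF v] compl_props(1)[OF a]
  have "u \<sqinter> (compl L v \<sqinter> compl L a) = \<bottom>"
    using le le_iff_disjoint_compl[of u "v \<squnion> a"] u v a by (simp add: compl_join)
  then show ?thesis
    using le_iff_disjoint_compl[of "u \<sqinter> compl L v" a] u v a c by (simp add: meet_assoc)
qed

end


section \<open>Lattices of sets ordered by inclusion\<close>

lemma partial_order_subset:
  assumes "eq K = (=)" "le K = (\<subseteq>)" shows "partial_order K"
  by unfold_locales (use assms in auto)

lemma is_lub_subset:
  assumes "le K = (\<subseteq>)" "S \<subseteq> carrier K" "s \<in> carrier K"
    and "\<And>a. a \<in> S \<Longrightarrow> a \<subseteq> s" "\<And>t. t \<in> carrier K \<Longrightarrow> \<forall>a\<in>S. a \<subseteq> t \<Longrightarrow> s \<subseteq> t"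
  shows "is_lub K s S"
proof -
  have "u \<in> Upper K S \<longleftrightarrow> u \<in> carrier K \<and> (\<forall>a\<in>S. a \<subseteq> u)" for u
    using assms(1,2) unfolding Upper_def by auto
  then show ?thesis
    using assms(3-5) by (simp add: least_def assms(1) Ball_def)
qed

lemma is_glb_subset:
  assumes "le K = (\<subseteq>)" "S \<subseteq> carrier K" "s \<in> carrier K"
    and "\<And>a. a \<in> S \<Longrightarrow> s \<subseteq> a" "\<And>t. t \<in> carrier K \<Longrightarrow> \<forall>a\<in>S. t \<subseteq> a \<Longrightarrow> t \<subseteq> s"
  shows "is_glb K s S"
proof -
  have "u \<in> Lower K S \<longleftrightarrow> u \<in> carrier K \<and> (\<forall>a\<in>S. u \<subseteq> a)" for u
    using assms(1,2) unfolding Lower_def by auto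
  then show ?thesis
    using assms(3-5) by (simp add: greatest_def assms(1) Ball_def)
qed


section \<open>Annihilator ideals of a meet-semilattice with zero\<close>

text \<open>A commutative idempotent semigroup with an absorbing zero, on an explicit carrier \<open>Q\<close>.\<close>

locale semilattice_with_zero =
  fixes Q :: "'a set" and mult :: "'a \<Rightarrow> 'a \<Rightarrow> 'a" (infixl "\<odot>" 70) and zero :: 'a ("\<zero>")
  assumes mult_closed: "\<lbrakk>x \<in> Q; y \<in> Q\<rbrakk> \<Longrightarrow> x \<odot> y \<in> Q"
    and mult_assoc: "\<lbrakk>x \<in> Q; y \<in> Q; z \<in> Q\<rbrakk> \<Longrightarrow> x \<odot> y \<odot> z = x \<odot> (y \<odot> z)"
    and mult_comm: "\<lbrakk>x \<in> Q; y \<in> Q\<rbrakk> \<Longrightarrow> x \<odot> y = y \<odot> x"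
    and mult_idem: "x \<in> Q \<Longrightarrow> x \<odot> x = x"
    and zero_closed: "\<zero> \<in> Q"
    and mult_zero: "x \<in> Q \<Longrightarrow> x \<odot> \<zero> = \<zero>"
begin

text \<open>The annihilator of \<open>S\<close>: the elements of \<open>Q\<close> disjoint from every element of \<open>S\<close>.\<close>

definition perp :: "'a set \<Rightarrow> 'a set"
  where "perp S = {q \<in> Q. \<forall>s\<in>S. q \<odot> s = \<zero>}"

text \<open>The annihilator ideals are the closed sets of the Galois connection given by \<open>perp\<close>, so
  meets are intersections and the join of a family is the double annihilator of its union.\<close>

definition annihilators :: "'a set set"
  where "annihilators = {S. S \<subseteq> Q \<and> perp (perp S) = S}"

lemma perp_subset: "perp S \<subseteq> Q"
  by (auto simp: perp_def)

lemma perp_antimono: "S \<subseteq> T \<Longrightarrow> perp T \<subseteq> perp S"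
  by (auto simp: perp_def)

lemma perp_perp_extensive: "S \<subseteq> Q \<Longrightarrow> S \<subseteq> perp (perp S)"
proof
  fix q assume S: "S \<subseteq> Q" and q: "q \<in> S"
  have "q \<odot> p = \<zero>" if "p \<in> perp S" for p
    using that q S mult_comm[of q p] by (auto simp: perp_def)
  then show "q \<in> perp (perp S)" using q S by (auto simp: perp_def)
qed

lemma perp_perp_perp: "S \<subseteq> Q \<Longrightarrow> perp (perp (perp S)) = perp S"
  by (intro antisym perp_antimono perp_perp_extensive perp_subset)

lemma perp_annihilator: "S \<subseteq> Q \<Longrightarrow> perp S \<in> annihilators"
  by (simp add: annihilators_def perp_subset perp_perp_perp)

lemma annihilatorsD: "S \<in> annihilators \<Longrightarrow> S \<subseteq> Q \<and> perp (perp S) = S"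
  by (simp add: annihilators_def)

lemma perp_perp_least: "S \<subseteq> T \<Longrightarrow> T \<in> annihilators \<Longrightarrow> perp (perp S) \<subseteq> T"
  using perp_antimono[OF perp_antimono, of S T] annihilatorsD by simp

lemma perp_mult:
  assumes q: "q \<in> perp S" and r: "r \<in> Q" and S: "S \<subseteq> Q" shows "q \<odot> r \<in> perp S"
proof -
  have "q \<odot> r \<odot> s = \<zero>" if "s \<in> S" for s
  proof -
    have m: "q \<in> Q" "s \<in> Q" "q \<odot> s = \<zero>" using q that S by (auto simp: perp_def)
    have "q \<odot> r \<odot> s = r \<odot> (q \<odot> s)" using m r mult_comm[of q r] mult_assoc[of r q s] by simp
    then show ?thesis using m(3) mult_zero r by simp
  qed
  then show ?thesis using q r mult_closed by (auto simp: perp_def)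
qed

lemma annihilator_mult: "S \<in> annihilators \<Longrightarrow> q \<in> S \<Longrightarrow> r \<in> Q \<Longrightarrow> q \<odot> r \<in> S"
  using perp_mult[of q "perp S" r] annihilatorsD[of S] perp_subset by simp

lemma Inter_annihilators:
  assumes "\<S> \<subseteq> annihilators" shows "Q \<inter> \<Inter>\<S> \<in> annihilators"
proof -
  have "perp (perp (Q \<inter> \<Inter>\<S>)) \<subseteq> S" if "S \<in> \<S>" for S
    by (rule perp_perp_least) (use that assms in auto)
  then show ?thesis
    using perp_perp_extensive[of "Q \<inter> \<Inter>\<S>"] perp_subset by (auto simp: annihilators_def)
qed

lemma perp_disjoint: "S \<subseteq> Q \<Longrightarrow> S \<inter> perp S \<subseteq> {\<zero>}"
proof
  fix q assume "S \<subseteq> Q" "q \<in> S \<inter> perp S"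
  then have "q \<in> Q" "q \<odot> q = \<zero>" by (auto simp: perp_def)
  then show "q \<in> {\<zero>}" using mult_idem by simp
qed

lemma zero_in_perp: "S \<subseteq> Q \<Longrightarrow> \<zero> \<in> perp S"
  using zero_closed mult_zero mult_comm[OF zero_closed] by (auto simp: perp_def subset_iff)

text \<open>The crucial point is distributivity. An element \<open>q\<close> of \<open>S\<close> below the join of \<open>T\<close> and
  \<open>U\<close> and an \<open>r\<close> annihilating \<open>S \<inter> T\<close> and \<open>S \<inter> U\<close> have a product that annihilates
  \<open>T \<union> U\<close>, hence also \<open>q\<close>; since \<open>q \<odot> (q \<odot> r) = q \<odot> r\<close>, this product is zero.\<close>

lemma annihilator_distrib:
  assumes S: "S \<in> annihilators" and T: "T \<in> annihilators" and U: "U \<in> annihilators"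
  shows "S \<inter> perp (perp (T \<union> U)) \<subseteq> perp (perp ((S \<inter> T) \<union> (S \<inter> U)))"
proof
  note sub = annihilatorsD[OF S] annihilatorsD[OF T] annihilatorsD[OF U]
  fix q assume q: "q \<in> S \<inter> perp (perp (T \<union> U))"
  have qQ: "q \<in> Q" using q sub by auto
  have "q \<odot> r = \<zero>" if r: "r \<in> perp ((S \<inter> T) \<union> (S \<inter> U))" for r
  proof -
    have rQ: "r \<in> Q" using r by (simp add: perp_def)
    have "q \<odot> r \<odot> t = \<zero>" if t: "t \<in> T \<union> U" for t
    proof -
      have tQ: "t \<in> Q" using t sub by auto
      have "q \<odot> t \<in> (S \<inter> T) \<union> (S \<inter> U)"
        using t q annihilator_mult[OF S, of q t] annihilator_mult[OF T, of t q]
          annihilator_mult[OF U, of t q] mult_comm[OF qQ tQ] qQ tQ by auto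
      then have "r \<odot> (q \<odot> t) = \<zero>" using r by (auto simp: perp_def)
      then show ?thesis using mult_comm[of q r] mult_assoc[of r q t] qQ rQ tQ by simp
    qed
    then have "q \<odot> r \<in> perp (T \<union> U)" using mult_closed qQ rQ by (simp add: perp_def)
    then have "q \<odot> (q \<odot> r) = \<zero>" using q by (auto simp: perp_def)
    then show ?thesis using mult_assoc[OF qQ qQ rQ] mult_idem[OF qQ] by simp
  qed
  then show "q \<in> perp (perp ((S \<inter> T) \<union> (S \<inter> U)))" using qQ by (simp add: perp_def)
qed

text \<open>The lattice \<open>K\<close> is any order structure on the annihilator ideals with inclusion as order, so
  that it may carry further record fields, such as the set of opens of an MT-algebra.\<close>

context
  fixes K :: "('a set, 'm) gorder_scheme"
  assumes carrier_K: "carrier K = annihilators" and eq_K: "eq K = (=)" and le_K: "le K = (\<subseteq>)"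
begin

lemma annihilators_is_lub: "\<S> \<subseteq> annihilators \<Longrightarrow> is_lub K (perp (perp (\<Union>\<S>))) \<S>"
proof (rule is_lub_subset[OF le_K], unfold carrier_K)
  assume S: "\<S> \<subseteq> annihilators"
  then have u: "\<Union>\<S> \<subseteq> Q" using annihilatorsD by blast
  show "perp (perp (\<Union>\<S>)) \<in> annihilators" by (rule perp_annihilator[OF perp_subset])
  show "a \<subseteq> perp (perp (\<Union>\<S>))" if "a \<in> \<S>" for a
    using perp_perp_extensive[OF u] that by blast
  show "perp (perp (\<Union>\<S>)) \<subseteq> t" if "t \<in> annihilators" "\<forall>a\<in>\<S>. a \<subseteq> t" for t
    by (rule perp_perp_least) (use that in auto)
qed

lemma annihilators_is_glb: "\<S> \<subseteq> annihilators \<Longrightarrow> is_glb K (Q \<inter> \<Inter>\<S>) \<S>"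
proof (rule is_glb_subset[OF le_K], unfold carrier_K)
  assume S: "\<S> \<subseteq> annihilators"
  show "Q \<inter> \<Inter>\<S> \<in> annihilators" by (rule Inter_annihilators[OF S])
  show "Q \<inter> \<Inter>\<S> \<subseteq> a" if "a \<in> \<S>" for a
    using that by auto
  show "t \<subseteq> Q \<inter> \<Inter>\<S>" if "t \<in> annihilators" "\<forall>a\<in>\<S>. t \<subseteq> a" for t
    using that annihilatorsD[of t] by auto
qed

lemma annihilators_Sup: "\<S> \<subseteq> annihilators \<Longrightarrow> \<Squnion>\<^bsub>K\<^esub>\<S> = perp (perp (\<Union>\<S>))"
  by (rule partial_order_lub_eq[OF partial_order_subset[OF eq_K le_K] annihilators_is_lub])

lemma annihilators_Inf: "\<S> \<subseteq> annihilators \<Longrightarrow> \<Sqinter>\<^bsub>K\<^esub>\<S> = Q \<inter> \<Inter>\<S>"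
  by (rule partial_order_glb_eq[OF partial_order_subset[OF eq_K le_K] annihilators_is_glb])

lemma annihilators_join:
  "S \<in> annihilators \<Longrightarrow> T \<in> annihilators \<Longrightarrow> S \<squnion>\<^bsub>K\<^esub> T = perp (perp (S \<union> T))"
  using annihilators_Sup[of "{S, T}"] by (simp add: join_def)

lemma annihilators_meet:
  "S \<in> annihilators \<Longrightarrow> T \<in> annihilators \<Longrightarrow> S \<sqinter>\<^bsub>K\<^esub> T = S \<inter> T"
  using annihilators_Inf[of "{S, T}"] annihilatorsD[of S] by (auto simp: meet_def)

lemma annihilators_top: "\<top>\<^bsub>K\<^esub> = Q"
proof (rule partial_order_top_eq[OF partial_order_subset[OF eq_K le_K]])
  show "greatest K Q (carrier K)"
    using Inter_annihilators[of "{}"] annihilatorsD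
    by (simp add: greatest_def carrier_K le_K subset_iff)
qed

lemma annihilators_bottom: "\<bottom>\<^bsub>K\<^esub> = {\<zero>}"
proof (rule partial_order_bottom_eq[OF partial_order_subset[OF eq_K le_K]])
  have "perp Q = {\<zero>}" using perp_disjoint[of Q] zero_in_perp[of Q] perp_subset by auto
  then have "{\<zero>} \<in> annihilators" using perp_annihilator[of Q] by simp
  moreover have "\<zero> \<in> S" if "S \<in> annihilators" for S
    using zero_in_perp[of "perp S"] annihilatorsD[OF that] perp_subset by metis
  ultimately show "least K {\<zero>} (carrier K)" by (auto simp: least_def carrier_K le_K)
qed

lemma perp_is_complement:
  assumes "S \<in> annihilators"
  shows "perp S \<in> annihilators" "S \<squnion>\<^bsub>K\<^esub> perp S = \<top>\<^bsub>K\<^esub>" "S \<sqinter>\<^bsub>K\<^esub> perp S = \<bottom>\<^bsub>K\<^esub>"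
proof -
  have S: "S \<subseteq> Q" using annihilatorsD[OF assms] by blast
  show p: "perp S \<in> annihilators" by (rule perp_annihilator[OF S])
  have "perp (S \<union> perp S) = perp S \<inter> perp (perp S)" by (auto simp: perp_def)
  also have "\<dots> \<subseteq> {\<zero>}" using perp_disjoint[OF perp_subset] .
  finally have "perp {\<zero>} \<subseteq> perp (perp (S \<union> perp S))" by (rule perp_antimono)
  moreover have "perp {\<zero>} = Q" using mult_zero by (auto simp: perp_def)
  ultimately show "S \<squnion>\<^bsub>K\<^esub> perp S = \<top>\<^bsub>K\<^esub>"
    using annihilators_join[OF assms p] annihilators_top perp_subset[of "perp (S \<union> perp S)"]
    by simp
  have "\<zero> \<in> S" using zero_in_perp[OF perp_subset, of S] annihilatorsD[OF assms] by simp
  then show "S \<sqinter>\<^bsub>K\<^esub> perp S = \<bottom>\<^bsub>K\<^esub>"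
    using annihilators_meet[OF assms p] annihilators_bottom perp_disjoint[OF S] zero_in_perp[OF S]
    by auto
qed

lemma annihilators_complete_boolean: "complete_boolean_lattice K"
proof -
  interpret partial_order K by (rule partial_order_subset[OF eq_K le_K])
  interpret complete_lattice K
    by unfold_locales (use annihilators_is_lub annihilators_is_glb carrier_K in auto)
  show ?thesis
  proof unfold_locales
    fix S T U assume a: "S \<in> carrier K" "T \<in> carrier K" "U \<in> carrier K"
    then have i: "S \<inter> T \<in> annihilators" "S \<inter> U \<in> annihilators"
      using annihilators_meet meet_closed carrier_K by metis+
    have "S \<sqinter>\<^bsub>K\<^esub> (T \<squnion>\<^bsub>K\<^esub> U) \<subseteq> (S \<sqinter>\<^bsub>K\<^esub> T) \<squnion>\<^bsub>K\<^esub> (S \<sqinter>\<^bsub>K\<^esub> U)"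
      using annihilator_distrib[of S T U] a join_closed[of T U]
      by (simp add: carrier_K annihilators_meet annihilators_join i)
    moreover have "le K ((S \<sqinter>\<^bsub>K\<^esub> T) \<squnion>\<^bsub>K\<^esub> (S \<sqinter>\<^bsub>K\<^esub> U)) (S \<sqinter>\<^bsub>K\<^esub> (T \<squnion>\<^bsub>K\<^esub> U))"
      using a meet_left meet_right join_left join_right
      by (intro join_le meet_le) (auto intro: le_trans[OF meet_right])
    ultimately show "S \<sqinter>\<^bsub>K\<^esub> (T \<squnion>\<^bsub>K\<^esub> U) = (S \<sqinter>\<^bsub>K\<^esub> T) \<squnion>\<^bsub>K\<^esub> (S \<sqinter>\<^bsub>K\<^esub> U)"
      by (simp add: le_K)
  next
    fix S assume "S \<in> carrier K"
    then have "S \<in> annihilators" by (simp add: carrier_K)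
    from perp_is_complement[OF this]
    show "\<exists>T\<in>carrier K. S \<squnion>\<^bsub>K\<^esub> T = \<top>\<^bsub>K\<^esub> \<and> S \<sqinter>\<^bsub>K\<^esub> T = \<bottom>\<^bsub>K\<^esub>"
      unfolding carrier_K by (intro bexI conjI)
  qed
qed

lemma annihilators_compl: "S \<in> annihilators \<Longrightarrow> compl K S = perp S"
  by (rule complete_boolean_lattice.compl_eq[OF annihilators_complete_boolean])
    (simp_all add: perp_is_complement carrier_K)

end
end


section \<open>Points of MT-algebras\<close>

lemma compl_mt_two: "compl mt_two b \<longleftrightarrow> \<not> b"
proof -
  interpret mt_algebra mt_two by (rule mt_two_algebra)
  have "b \<in> carrier mt_two" by (simp add: mt_two_def)
  from compl_props(2,3)[OF this] show ?thesis by (cases b) auto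
qed

context mt_algebra
begin

lemma points_iff:
  "f \<in> points A \<longleftrightarrow> f \<in> extensional (carrier A) \<and>
    (\<forall>S\<subseteq>carrier A. f (\<Squnion>S) \<longleftrightarrow> (\<exists>s\<in>S. f s)) \<and>
    (\<forall>S\<subseteq>carrier A. f (\<Sqinter>S) \<longleftrightarrow> (\<forall>s\<in>S. f s)) \<and>
    (\<forall>x\<in>carrier A. f (compl A x) \<longleftrightarrow> \<not> f x)"
proof -
  interpret T: mt_algebra mt_two by (rule mt_two_algebra)
  have *: "True \<in> f ` S \<longleftrightarrow> (\<exists>s\<in>S. f s)" "False \<notin> f ` S \<longleftrightarrow> (\<forall>s\<in>S. f s)" for S by auto
  have c: "carrier mt_two = UNIV" "opens mt_two = UNIV" by (simp_all add: mt_two_def)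
  show ?thesis
    unfolding points_def mt_hom_def sup_pres_def inf_pres_def mt_two_ops compl_mt_two * c
    by (simp add: PiE_def complete_lattice_axioms T.complete_lattice_axioms)
qed

lemma points_Sup: "f \<in> points A \<Longrightarrow> S \<subseteq> carrier A \<Longrightarrow> f (\<Squnion>S) \<longleftrightarrow> (\<exists>s\<in>S. f s)"
  and points_Inf: "f \<in> points A \<Longrightarrow> S \<subseteq> carrier A \<Longrightarrow> f (\<Sqinter>S) \<longleftrightarrow> (\<forall>s\<in>S. f s)"
  and points_compl: "f \<in> points A \<Longrightarrow> x \<in> carrier A \<Longrightarrow> f (compl A x) \<longleftrightarrow> \<not> f x"
  and points_extensional: "f \<in> points A \<Longrightarrow> f \<in> extensional (carrier A)"
  by (simp_all add: points_iff)

lemma points_meet: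
  "f \<in> points A \<Longrightarrow> x \<in> carrier A \<Longrightarrow> y \<in> carrier A \<Longrightarrow> f (x \<sqinter> y) \<longleftrightarrow> f x \<and> f y"
  using points_Inf[of f "{x, y}"] by (simp add: meet_def)

lemma points_mono:
  "f \<in> points A \<Longrightarrow> x \<in> carrier A \<Longrightarrow> y \<in> carrier A \<Longrightarrow> x \<sqsubseteq> y \<Longrightarrow> f x \<Longrightarrow> f y"
  by (metis le_iff_join points_meet)

lemma points_top: "f \<in> points A \<Longrightarrow> f \<top>"
  using points_Inf[of f "{}"] points_mono[of f "\<Sqinter>{}" "\<top>"] top_higher by simp

text \<open>By the \<open>T\<^sub>0\<close> axiom, the opens generate the algebra under the complete Boolean operations.\<close>

lemma opens_generate [consumes 1, case_names opens Inf Sup compl]: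
  assumes x: "x \<in> carrier A"
    and opens: "\<And>a. a \<in> opens A \<Longrightarrow> P a"
    and Inf: "\<And>S. S \<subseteq> carrier A \<Longrightarrow> \<forall>s\<in>S. P s \<Longrightarrow> P (\<Sqinter>S)"
    and Sup: "\<And>S. S \<subseteq> carrier A \<Longrightarrow> \<forall>s\<in>S. P s \<Longrightarrow> P (\<Squnion>S)"
    and compl: "\<And>y. y \<in> carrier A \<Longrightarrow> P y \<Longrightarrow> P (compl A y)"
  shows "P x"
proof -
  have "P ((\<Sqinter>S) \<sqinter> compl A a)" if S: "S \<subseteq> opens A" and a: "a \<in> opens A" for S a
  proof -
    have S': "S \<subseteq> carrier A" and a': "a \<in> carrier A" using S a opens_carrier by auto
    have "P (\<Sqinter>S)" using S S' opens by (intro Inf) auto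
    moreover have "P (compl A a)" using a a' opens by (intro compl)
    ultimately show ?thesis
      unfolding meet_def using S' compl_props(1)[OF a'] by (intro Inf) auto
  qed
  then have basic: "P z" if "z \<in> basic_elements A" for z
    using that by (auto simp: basic_elements_def)
  obtain B where "B \<subseteq> basic_elements A" "x = \<Squnion>B" using T0[OF x] by blast
  then show ?thesis using Sup[of B] basic basic_elements_carrier by auto
qed

lemma points_eqI:
  assumes f: "f \<in> points A" and g: "g \<in> points A" and eq: "\<And>a. a \<in> opens A \<Longrightarrow> f a \<longleftrightarrow> g a"
  shows "f = g"
proof (rule extensionalityI[OF points_extensional[OF f] points_extensional[OF g]])
  fix x assume "x \<in> carrier A"
  then show "f x = g x"
  proof (induction rule: opens_generate)
    case (opens a) then show ?case by (rule eq)
  next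
    case (Inf S) then show ?case using points_Inf[OF f] points_Inf[OF g] by simp
  next
    case (Sup S) then show ?case using points_Sup[OF f] points_Sup[OF g] by simp
  next
    case (compl y) then show ?case using points_compl[OF f] points_compl[OF g] by simp
  qed
qed

text \<open>Because the opens generate the algebra, a nonzero element that splits no open is an atom,
  hence a point.\<close>

lemma atom_point:
  assumes c: "c \<in> carrier A" "c \<noteq> \<bottom>"
    and split: "\<And>a. a \<in> opens A \<Longrightarrow> c \<sqsubseteq> a \<or> c \<sqinter> a = \<bottom>"
  shows "(\<lambda>m\<in>carrier A. c \<sqsubseteq> m) \<in> points A"
proof -
  have not_both: "\<not> (c \<sqsubseteq> m \<and> c \<sqinter> m = \<bottom>)" if "m \<in> carrier A" for m
    using that c le_iff_join[OF c(1) that] by auto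
  have atom: "c \<sqsubseteq> m \<or> c \<sqinter> m = \<bottom>" if "m \<in> carrier A" for m
    using that
  proof (induction rule: opens_generate)
    case (opens a) then show ?case by (rule split)
  next
    case (Inf S)
    show ?case
    proof (cases "\<forall>s\<in>S. c \<sqsubseteq> s")
      case True
      then have "c \<sqsubseteq> \<Sqinter>S" using Inf(1) c by (intro inf_greatest) auto
      then show ?thesis ..
    next
      case False
      then obtain s where s: "s \<in> S" "c \<sqinter> s = \<bottom>" using Inf(2) by blast
      have "s \<in> carrier A" using s Inf(1) by auto
      moreover have "\<Sqinter>S \<sqsubseteq> s" using s Inf(1) by (intro inf_lower)
      ultimately have "c \<sqinter> \<Sqinter>S \<sqsubseteq> c \<sqinter> s"
        using c Inf(1) le_trans[OF meet_right[of c "\<Sqinter>S"], of s]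
        by (intro meet_le meet_left) auto
      then have "c \<sqinter> \<Sqinter>S = \<bottom>" unfolding s(2) using c Inf(1) by (intro le_antisym) auto
      then show ?thesis ..
    qed
  next
    case (Sup S)
    show ?case
    proof (cases "\<exists>s\<in>S. c \<sqsubseteq> s")
      case True
      then obtain s where s: "s \<in> S" "c \<sqsubseteq> s" by blast
      then have "c \<sqsubseteq> \<Squnion>S" using Sup(1) c le_trans[OF s(2) sup_upper] by auto
      then show ?thesis ..
    next
      case False
      then have "\<forall>s\<in>S. c \<sqinter> s = \<bottom>" using Sup(2) by simp
      then show ?thesis by (simp add: disjoint_Sup_iff[OF c(1) Sup(1)])
    qed
  next
    case (compl y)
    then show ?case
      using disjoint_iff_le_compl[OF c(1), of y] le_iff_disjoint_compl[OF c(1), of y] compl by argo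
  qed
  show ?thesis
    unfolding points_iff
  proof (intro conjI allI ballI impI)
    fix S assume S: "S \<subseteq> carrier A"
    have iff: "c \<sqsubseteq> m \<longleftrightarrow> c \<sqinter> m \<noteq> \<bottom>" if "m \<in> carrier A" for m
      using atom[OF that] not_both[OF that] by argo
    have "\<forall>s\<in>S. c \<sqsubseteq> s \<longleftrightarrow> c \<sqinter> s \<noteq> \<bottom>" using iff S by auto
    then have "c \<sqsubseteq> \<Squnion>S \<longleftrightarrow> (\<exists>s\<in>S. c \<sqsubseteq> s)"
      using iff[of "\<Squnion>S"] S disjoint_Sup_iff[OF c(1) S] by simp
    then show "(\<lambda>m\<in>carrier A. c \<sqsubseteq> m) (\<Squnion>S) \<longleftrightarrow> (\<exists>s\<in>S. (\<lambda>m\<in>carrier A. c \<sqsubseteq> m) s)"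
      using S by (auto simp: subset_iff)
    have "c \<sqsubseteq> \<Sqinter>S \<longleftrightarrow> (\<forall>s\<in>S. c \<sqsubseteq> s)"
    proof
      assume le: "c \<sqsubseteq> \<Sqinter>S"
      show "\<forall>s\<in>S. c \<sqsubseteq> s" using le_trans[OF le inf_lower] S c by auto
    qed (use S c in \<open>auto intro: inf_greatest\<close>)
    then show "(\<lambda>m\<in>carrier A. c \<sqsubseteq> m) (\<Sqinter>S) \<longleftrightarrow> (\<forall>s\<in>S. (\<lambda>m\<in>carrier A. c \<sqsubseteq> m) s)"
      using S by (auto simp: subset_iff)
  next
    fix x assume x: "x \<in> carrier A"
    then show "(\<lambda>m\<in>carrier A. c \<sqsubseteq> m) (compl A x) \<longleftrightarrow> \<not> (\<lambda>m\<in>carrier A. c \<sqsubseteq> m) x"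
      using disjoint_iff_le_compl[OF c(1) x] atom[OF x] not_both[OF x] compl_props(1)[OF x] by auto
  qed simp
qed

end

text \<open>Points pull back along morphisms.\<close>

lemma points_comp:
  assumes C: "mt_algebra C" and A: "mt_algebra A" and p: "p \<in> mt_hom C A" and f: "f \<in> points A"
  shows "restrict (f \<circ> p) (carrier C) \<in> points C"
proof -
  interpret C: mt_algebra C by fact
  interpret A: mt_algebra A by fact
  have h: "\<And>x. x \<in> carrier C \<Longrightarrow> p x \<in> carrier A"
    "\<And>S. S \<subseteq> carrier C \<Longrightarrow> p (\<Squnion>\<^bsub>C\<^esub>S) = \<Squnion>\<^bsub>A\<^esub>(p ` S)"
    "\<And>S. S \<subseteq> carrier C \<Longrightarrow> p (\<Sqinter>\<^bsub>C\<^esub>S) = \<Sqinter>\<^bsub>A\<^esub>(p ` S)"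
    "\<And>x. x \<in> carrier C \<Longrightarrow> p (compl C x) = compl A (p x)"
    using p by (auto simp: mt_hom_def sup_pres_def inf_pres_def)
  have im: "p ` S \<subseteq> carrier A" if "S \<subseteq> carrier C" for S using h(1) that by blast
  show ?thesis
    unfolding C.points_iff
  proof (intro conjI allI ballI impI)
    fix S assume S: "S \<subseteq> carrier C"
    show "restrict (f \<circ> p) (carrier C) (\<Squnion>\<^bsub>C\<^esub>S) \<longleftrightarrow> (\<exists>s\<in>S. restrict (f \<circ> p) (carrier C) s)"
      using S by (simp add: h(2) A.points_Sup[OF f im[OF S]] subset_iff)
    show "restrict (f \<circ> p) (carrier C) (\<Sqinter>\<^bsub>C\<^esub>S) \<longleftrightarrow> (\<forall>s\<in>S. restrict (f \<circ> p) (carrier C) s)"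
      using S by (simp add: h(3) A.points_Inf[OF f im[OF S]] subset_iff)
  next
    fix x assume x: "x \<in> carrier C"
    then show "restrict (f \<circ> p) (carrier C) (compl C x) \<longleftrightarrow> \<not> restrict (f \<circ> p) (carrier C) x"
      by (simp add: h C.compl_props(1) A.points_compl[OF f])
  qed simp
qed

lemma topspace_spectrum:
  assumes "mt_algebra A" shows "topspace (spectrum A) = points A"
proof -
  interpret mt_algebra A by fact
  have "\<top>\<^bsub>A\<^esub> \<in> opens A" using opens_subframe by (simp add: subframe_def)
  moreover have "points A = {f \<in> points A. f \<top>\<^bsub>A\<^esub>}" using points_top by blast
  ultimately have "openin (spectrum A) (points A)"
    unfolding openin_spectrum[OF assms] by blast
  moreover have "topspace (spectrum A) \<subseteq> points A"
    using openin_topspace[of "spectrum A"] unfolding openin_spectrum[OF assms] by blast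
  ultimately show ?thesis using openin_subset by blast
qed


section \<open>The powerset algebra of a space\<close>

text \<open>The powerset of a space with its open sets. It is an MT-algebra only when the \<open>T\<^sub>0\<close> axiom
  holds, for instance for a \<open>T\<^sub>D\<close>-space.\<close>

definition powerset_mt :: "'a topology \<Rightarrow> 'a set mt"
  where "powerset_mt X =
    \<lparr>carrier = Pow (topspace X), eq = (=), le = (\<subseteq>), opens = {U. openin X U}\<rparr>"

lemma powerset_mt_simps [simp]:
  "carrier (powerset_mt X) = Pow (topspace X)" "eq (powerset_mt X) = (=)"
  "le (powerset_mt X) = (\<subseteq>)" "opens (powerset_mt X) = {U. openin X U}"
  by (simp_all add: powerset_mt_def)

lemma powerset_is_lub: "S \<subseteq> Pow (topspace X) \<Longrightarrow> is_lub (powerset_mt X) (\<Union>S) S"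
  by (rule is_lub_subset) auto

lemma powerset_is_glb: "S \<subseteq> Pow (topspace X) \<Longrightarrow> is_glb (powerset_mt X) (topspace X \<inter> \<Inter>S) S"
  by (rule is_glb_subset) auto

lemma powerset_Sup: "S \<subseteq> Pow (topspace X) \<Longrightarrow> \<Squnion>\<^bsub>powerset_mt X\<^esub>S = \<Union>S"
  by (rule partial_order_lub_eq[OF partial_order_subset powerset_is_lub]) auto

lemma powerset_Inf: "S \<subseteq> Pow (topspace X) \<Longrightarrow> \<Sqinter>\<^bsub>powerset_mt X\<^esub>S = topspace X \<inter> \<Inter>S"
  by (rule partial_order_glb_eq[OF partial_order_subset powerset_is_glb]) auto

lemma powerset_join:
  "U \<subseteq> topspace X \<Longrightarrow> V \<subseteq> topspace X \<Longrightarrow> U \<squnion>\<^bsub>powerset_mt X\<^esub> V = U \<union> V"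
  using powerset_Sup[of "{U, V}" X] by (simp add: join_def)

lemma powerset_meet:
  "U \<subseteq> topspace X \<Longrightarrow> V \<subseteq> topspace X \<Longrightarrow> U \<sqinter>\<^bsub>powerset_mt X\<^esub> V = U \<inter> V"
  using powerset_Inf[of "{U, V}" X] by (auto simp: meet_def)

lemma powerset_top: "\<top>\<^bsub>powerset_mt X\<^esub> = topspace X"
  by (rule partial_order_top_eq[OF partial_order_subset]) (auto simp: greatest_def)

lemma powerset_bottom: "\<bottom>\<^bsub>powerset_mt X\<^esub> = {}"
  by (rule partial_order_bottom_eq[OF partial_order_subset]) (auto simp: least_def)

lemma powerset_complete_boolean: "complete_boolean_lattice (powerset_mt X)"
proof -
  interpret partial_order "powerset_mt X" by (rule partial_order_subset) simp_all
  interpret complete_lattice "powerset_mt X"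
    by unfold_locales (auto intro!: exI powerset_is_lub powerset_is_glb)
  show ?thesis
  proof unfold_locales
    fix S T U
    assume "S \<in> carrier (powerset_mt X)" "T \<in> carrier (powerset_mt X)" "U \<in> carrier (powerset_mt X)"
    then have s: "S \<subseteq> topspace X" "T \<subseteq> topspace X" "U \<subseteq> topspace X" by simp_all
    then have "S \<inter> T \<subseteq> topspace X" "S \<inter> U \<subseteq> topspace X" "T \<union> U \<subseteq> topspace X" by auto
    with s show "S \<sqinter>\<^bsub>powerset_mt X\<^esub> (T \<squnion>\<^bsub>powerset_mt X\<^esub> U) =
      (S \<sqinter>\<^bsub>powerset_mt X\<^esub> T) \<squnion>\<^bsub>powerset_mt X\<^esub> (S \<sqinter>\<^bsub>powerset_mt X\<^esub> U)"
      by (simp add: powerset_join powerset_meet Int_Un_distrib)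
  next
    fix S assume "S \<in> carrier (powerset_mt X)"
    then show "\<exists>T\<in>carrier (powerset_mt X). S \<squnion>\<^bsub>powerset_mt X\<^esub> T = \<top>\<^bsub>powerset_mt X\<^esub> \<and>
      S \<sqinter>\<^bsub>powerset_mt X\<^esub> T = \<bottom>\<^bsub>powerset_mt X\<^esub>"
      by (intro bexI[of _ "topspace X - S"])
        (auto simp: powerset_join powerset_meet powerset_top powerset_bottom)
  qed
qed

lemma powerset_compl: "S \<subseteq> topspace X \<Longrightarrow> compl (powerset_mt X) S = topspace X - S"
  by (rule complete_boolean_lattice.compl_eq[OF powerset_complete_boolean])
    (auto simp: powerset_join powerset_meet powerset_top powerset_bottom)

text \<open>A family of points of an algebra, indexed by a space on which each open of the algebra cuts
  out an open set, induces a morphism into the powerset algebra of that space.\<close>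

lemma (in mt_algebra) mt_hom_into_powerset:
  assumes f: "\<And>x. x \<in> topspace X \<Longrightarrow> f x \<in> points A"
    and op: "\<And>a. a \<in> opens A \<Longrightarrow> openin X {x \<in> topspace X. f x a}"
  shows "(\<lambda>m\<in>carrier A. {x \<in> topspace X. f x m}) \<in> mt_hom A (powerset_mt X)" (is "?p \<in> _")
proof -
  have cl: "complete_lattice (powerset_mt X)"
    using powerset_complete_boolean by (rule complete_boolean_lattice.axioms)
  have p: "?p ` S \<subseteq> Pow (topspace X)" if "S \<subseteq> carrier A" for S
    using that by auto
  show ?thesis
    unfolding mt_hom_def sup_pres_def inf_pres_def
  proof (intro CollectI conjI allI impI ballI complete_lattice_axioms cl)
    show "?p \<in> carrier A \<rightarrow>\<^sub>E carrier (powerset_mt X)" by auto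
  next
    fix S assume S: "S \<subseteq> carrier A"
    show "?p (\<Squnion>S) = \<Squnion>\<^bsub>powerset_mt X\<^esub>(?p ` S)"
      unfolding powerset_Sup[OF p[OF S]] using S points_Sup[OF f] by (auto simp: subset_iff)
    show "?p (\<Sqinter>S) = \<Sqinter>\<^bsub>powerset_mt X\<^esub>(?p ` S)"
      unfolding powerset_Inf[OF p[OF S]] using S points_Inf[OF f] by (auto simp: subset_iff)
  next
    fix x assume "x \<in> carrier A"
    then show "?p (compl A x) = compl (powerset_mt X) (?p x)"
      using compl_props(1) points_compl[OF f] by (auto simp: powerset_compl)
  next
    show "?p ` opens A \<subseteq> opens (powerset_mt X)"
      using op opens_carrier by (auto simp: subset_iff)
  qed
qed

text \<open>Points are differences of open sets; this form speaks of opens only and so transfers to any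
  algebra with the same frame of opens.\<close>

lemma TD_space_iff:
  "TD_space X \<longleftrightarrow> (\<forall>x\<in>topspace X. \<exists>U V. openin X U \<and> openin X V \<and> {x} = U - V)"
proof -
  have "(\<exists>C. closedin X C \<and> {x} = U \<inter> C) \<longleftrightarrow> (\<exists>V. openin X V \<and> {x} = U - V)"
    if U: "openin X U" for x U
  proof
    assume "\<exists>C. closedin X C \<and> {x} = U \<inter> C"
    then obtain C where "closedin X C" "{x} = U \<inter> C" by blast
    then show "\<exists>V. openin X V \<and> {x} = U - V"
      using openin_subset[OF U] by (intro exI[of _ "topspace X - C"]) (auto simp: closedin_def)
  next
    assume "\<exists>V. openin X V \<and> {x} = U - V"
    then obtain V where "openin X V" "{x} = U - V" by blast
    then show "\<exists>C. closedin X C \<and> {x} = U \<inter> C"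
      using openin_subset[OF U] by (intro exI[of _ "topspace X - V"]) auto
  qed
  then show ?thesis unfolding TD_space_def by meson
qed

lemma powerset_mt_algebra:
  assumes "TD_space X" shows "mt_algebra (powerset_mt X)"
proof -
  interpret complete_boolean_lattice "powerset_mt X" by (rule powerset_complete_boolean)
  show ?thesis
  proof unfold_locales
    have "U \<sqinter>\<^bsub>powerset_mt X\<^esub> V \<in> opens (powerset_mt X)"
      if "U \<in> opens (powerset_mt X)" "V \<in> opens (powerset_mt X)" for U V
      using that openin_subset[of X U] openin_subset[of X V] by (simp add: powerset_meet openin_Int)
    moreover have "\<Squnion>\<^bsub>powerset_mt X\<^esub>S \<in> opens (powerset_mt X)" if "S \<subseteq> opens (powerset_mt X)" for S
    proof -
      have "S \<subseteq> Pow (topspace X)" using that by (auto dest: openin_subset)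
      then show ?thesis using that by (simp add: powerset_Sup openin_Union subset_iff)
    qed
    ultimately show "subframe (opens (powerset_mt X)) (powerset_mt X)"
      by (auto simp: subframe_def powerset_top dest: openin_subset)
  next
    fix S assume S: "S \<in> carrier (powerset_mt X)"
    have "{x} \<in> basic_elements (powerset_mt X)" if x: "x \<in> topspace X" for x
    proof -
      obtain U V where UV: "openin X U" "openin X V" "{x} = U - V"
        using assms x unfolding TD_space_iff by blast
      note s = openin_subset[OF UV(1)] openin_subset[OF UV(2)]
      have "\<Sqinter>\<^bsub>powerset_mt X\<^esub>{U} = U" using s powerset_Inf[of "{U}" X] by auto
      then have "{x} = \<Sqinter>\<^bsub>powerset_mt X\<^esub>{U} \<sqinter>\<^bsub>powerset_mt X\<^esub> compl (powerset_mt X) V"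
        using s UV(3) by (auto simp: powerset_compl powerset_meet)
      then show ?thesis
        unfolding basic_elements_def using UV(1,2)
        by (intro CollectI exI[of _ "{U}"] exI[of _ V]) simp
    qed
    then have "(\<lambda>x. {x}) ` S \<subseteq> basic_elements (powerset_mt X)" using S by auto
    moreover have "S = \<Squnion>\<^bsub>powerset_mt X\<^esub>((\<lambda>x. {x}) ` S)"
      using S powerset_Sup[of "(\<lambda>x. {x}) ` S" X] by auto
    ultimately show "\<exists>B\<subseteq>basic_elements (powerset_mt X). S = \<Squnion>\<^bsub>powerset_mt X\<^esub>B" by blast
  qed
qed

lemma homeomorphic_spectrum_powerset:
  assumes A: "mt_algebra (powerset_mt X)"
  shows "X homeomorphic_space spectrum (powerset_mt X)"
proof -
  interpret mt_algebra "powerset_mt X" by fact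
  define \<phi> where "\<phi> x = (\<lambda>S\<in>Pow (topspace X). x \<in> S)" for x
  have pt: "\<phi> x \<in> points (powerset_mt X)" if "x \<in> topspace X" for x
    unfolding points_iff using that
    by (auto simp: \<phi>_def powerset_Sup powerset_Inf powerset_compl subset_iff)
  \<comment> \<open>The top element is the join of the singletons, so every point is true on a singleton.\<close>
  have surj: "\<exists>x\<in>topspace X. f = \<phi> x" if f: "f \<in> points (powerset_mt X)" for f
  proof -
    let ?S = "(\<lambda>x. {x}) ` topspace X"
    have "?S \<subseteq> carrier (powerset_mt X)" by auto
    moreover have "\<Squnion>\<^bsub>powerset_mt X\<^esub>?S = \<top>\<^bsub>powerset_mt X\<^esub>"
      by (subst powerset_Sup) (auto simp: powerset_top)
    ultimately obtain x where x: "x \<in> topspace X" "f {x}"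
      using points_Sup[OF f, of ?S] points_top[OF f] by auto
    have "f S \<longleftrightarrow> x \<in> S" if S: "S \<subseteq> topspace X" for S
    proof
      assume "x \<in> S" then show "f S" using points_mono[OF f, of "{x}" S] x S by simp
    next
      assume fS: "f S"
      show "x \<in> S"
      proof (rule ccontr)
        assume "x \<notin> S"
        then have "f (compl (powerset_mt X) S)"
          using points_mono[OF f, of "{x}" "topspace X - S"] x S by (simp add: powerset_compl)
        then show False using points_compl[OF f, of S] fS S by simp
      qed
    qed
    then have "f = \<phi> x"
      by (intro extensionalityI[OF points_extensional[OF f]]) (auto simp: \<phi>_def)
    then show ?thesis using x(1) by blast
  qed
  have img: "\<phi> ` topspace X = points (powerset_mt X)" using pt surj by blast
  have pre: "\<phi> ` U = {f \<in> points (powerset_mt X). f U}" if "U \<subseteq> topspace X" for U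
    using that by (auto simp: img[symmetric] \<phi>_def)
  have inj: "inj_on \<phi> (topspace X)"
  proof (rule inj_onI)
    fix x y assume xy: "x \<in> topspace X" "y \<in> topspace X" "\<phi> x = \<phi> y"
    then have "\<phi> x {y} = \<phi> y {y}" by simp
    then show "x = y" using xy by (simp add: \<phi>_def)
  qed
  have "homeomorphic_map X (spectrum (powerset_mt X)) \<phi>"
  proof (rule bijective_open_imp_homeomorphic_map)
    show "open_map X (spectrum (powerset_mt X)) \<phi>"
      unfolding open_map_def openin_spectrum[OF A] using pre[OF openin_subset] by auto
    show "continuous_map X (spectrum (powerset_mt X)) \<phi>"
      unfolding continuous_map_def topspace_spectrum[OF A] openin_spectrum[OF A]
    proof (intro conjI allI impI)
      show "\<phi> \<in> topspace X \<rightarrow> points (powerset_mt X)" using pt by blast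
      fix W assume "\<exists>U\<in>opens (powerset_mt X). W = {f \<in> points (powerset_mt X). f U}"
      then obtain U where U: "openin X U" "W = {f \<in> points (powerset_mt X). f U}" by auto
      then have "{x \<in> topspace X. \<phi> x \<in> W} = U"
        using pt openin_subset[OF U(1)] by (auto simp: \<phi>_def)
      then show "openin X {x \<in> topspace X. \<phi> x \<in> W}" using U(1) by simp
    qed
  qed (use img inj topspace_spectrum[OF A] in simp_all)
  then show ?thesis by (rule homeomorphic_map_imp_homeomorphic_space)
qed


section \<open>The powerset algebra of a \<open>T\<^sub>D\<close>-space is fiber-terminal\<close>

context mt_algebra
begin

lemma open_frame_Sup: "S \<subseteq> opens A \<Longrightarrow> \<Squnion>\<^bsub>open_frame A\<^esub>S = \<Squnion>S"
  by (rule partial_order_lub_eq[OF open_frame_partial_order open_frame_lub])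

lemma open_frame_meet: "a \<in> opens A \<Longrightarrow> b \<in> opens A \<Longrightarrow> a \<sqinter>\<^bsub>open_frame A\<^esub> b = a \<sqinter> b"
  using partial_order_glb_eq[OF open_frame_partial_order open_frame_glb] by (simp add: meet_def)

lemma open_meet: "a \<in> opens A \<Longrightarrow> b \<in> opens A \<Longrightarrow> a \<sqinter> b \<in> opens A"
  and open_Sup: "S \<subseteq> opens A \<Longrightarrow> \<Squnion>S \<in> opens A"
  and open_top: "\<top> \<in> opens A"
  using opens_subframe by (simp_all add: subframe_def)

lemma open_join: "a \<in> opens A \<Longrightarrow> b \<in> opens A \<Longrightarrow> a \<squnion> b \<in> opens A"
  using open_Sup[of "{a, b}"] by (simp add: join_def)

end

text \<open>The member \<open>C\<close> of the fiber may live on any type.\<close>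

lemma powerset_fiber_top:
  assumes TD: "TD_space X" and fib: "(C, \<theta>) \<in> fiber (open_frame (powerset_mt X))"
  shows "fiber_le (C, \<theta>) (powerset_mt X, id)"
proof -
  interpret P: mt_algebra "powerset_mt X" by (rule powerset_mt_algebra[OF TD])
  interpret C: mt_algebra C using fib by (simp add: fiber_def)
  have \<theta>: "\<theta> \<in> frame_hom (open_frame C) (open_frame (powerset_mt X))"
    and bij: "bij_betw \<theta> (opens C) {U. openin X U}"
    using fib by (auto simp: fiber_def frame_iso_def open_frame_def)
  have op: "openin X (\<theta> a)" if "a \<in> opens C" for a
    using bij that by (auto simp: bij_betw_def)
  note sub = openin_subset[OF op]
  have meet: "\<theta> (a \<sqinter>\<^bsub>C\<^esub> b) = \<theta> a \<inter> \<theta> b" if "a \<in> opens C" "b \<in> opens C" for a b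
  proof -
    have "\<theta> (a \<sqinter>\<^bsub>open_frame C\<^esub> b) = \<theta> a \<sqinter>\<^bsub>open_frame (powerset_mt X)\<^esub> \<theta> b"
      using \<theta> that by (simp add: frame_hom_def open_frame_def)
    then show ?thesis
      using that op sub by (simp add: C.open_frame_meet P.open_frame_meet powerset_meet)
  qed
  have join: "\<theta> (a \<squnion>\<^bsub>C\<^esub> b) = \<theta> a \<union> \<theta> b" if "a \<in> opens C" "b \<in> opens C" for a b
  proof -
    have "{a, b} \<subseteq> carrier (open_frame C)" using that by (simp add: open_frame_def)
    then have "\<theta> (\<Squnion>\<^bsub>open_frame C\<^esub>{a, b}) = \<Squnion>\<^bsub>open_frame (powerset_mt X)\<^esub>(\<theta> ` {a, b})"
      using \<theta> by (simp add: frame_hom_def)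
    then show ?thesis
      using that op sub by (simp add: C.open_frame_Sup P.open_frame_Sup powerset_Sup join_def)
  qed
  have le: "le C a b \<longleftrightarrow> \<theta> a \<subseteq> \<theta> b" if ab: "a \<in> opens C" "b \<in> opens C" for a b
  proof -
    have "le C a b \<longleftrightarrow> a = a \<sqinter>\<^bsub>C\<^esub> b" 
      by (rule C.le_iff_join) (use ab C.opens_carrier in auto)
    also have "\<dots> \<longleftrightarrow> \<theta> a = \<theta> (a \<sqinter>\<^bsub>C\<^esub> b)"
      
      using inj_on_eq_iff[OF bij_betw_imp_inj_on[OF bij] ab(1) C.open_meet[OF ab]] by simp
    finally show ?thesis using meet[OF ab] by auto
  qed
  have "\<exists>f\<in>points C. \<forall>a\<in>opens C. f a \<longleftrightarrow> x \<in> \<theta> a" if x: "x \<in> topspace X" for x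
  proof -
    obtain U V where UV: "openin X U" "openin X V" "{x} = U - V"
      using TD x unfolding TD_space_iff by blast
    have "U \<in> \<theta> ` opens C" "V \<in> \<theta> ` opens C" using bij UV(1,2) by (auto simp: bij_betw_def)
    then obtain u v where uv: "u \<in> opens C" "v \<in> opens C" "U = \<theta> u" "V = \<theta> v" by blast
    note c = subsetD[OF C.opens_carrier] C.compl_props(1)
    \<comment> \<open>This element corresponds to \<open>U - V\<close>; it is an atom of \<open>C\<close> although \<open>C\<close> need not be atomic.\<close>
    let ?c = "u \<sqinter>\<^bsub>C\<^esub> compl C v"
    have cc: "?c \<in> carrier C" using uv c by (intro C.meet_closed) auto
    have nz: "?c \<noteq> \<bottom>\<^bsub>C\<^esub>"
      using C.le_iff_disjoint_compl[of u v] le[of u v] uv c UV(3) by auto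
    have below: "le C ?c a" if "a \<in> opens C" "x \<in> \<theta> a" for a
    proof -
      have "\<theta> u \<subseteq> \<theta> (v \<squnion>\<^bsub>C\<^esub> a)" using join[of v a] that uv UV(3) by auto
      then have "le C u (v \<squnion>\<^bsub>C\<^esub> a)" by (simp add: le uv that C.open_join)
      then show ?thesis using uv that c(1) by (intro C.diff_le)
    qed
    have disj: "?c \<sqinter>\<^bsub>C\<^esub> a = \<bottom>\<^bsub>C\<^esub>" if a: "a \<in> opens C" "x \<notin> \<theta> a" for a
    proof -
      have "\<theta> (u \<sqinter>\<^bsub>C\<^esub> a) \<subseteq> \<theta> v" using meet[of u a] a uv UV(3) by auto
      then have "le C (u \<sqinter>\<^bsub>C\<^esub> a) v" by (simp add: le uv a C.open_meet)
      then have "(u \<sqinter>\<^bsub>C\<^esub> a) \<sqinter>\<^bsub>C\<^esub> compl C v = \<bottom>\<^bsub>C\<^esub>"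
        
        using C.le_iff_disjoint_compl[of "u \<sqinter>\<^bsub>C\<^esub> a" v] uv a c(1) C.open_meet by simp
      moreover have "?c \<sqinter>\<^bsub>C\<^esub> a = u \<sqinter>\<^bsub>C\<^esub> (compl C v \<sqinter>\<^bsub>C\<^esub> a)"
        using uv a c by (intro C.meet_assoc) auto
      moreover have "(u \<sqinter>\<^bsub>C\<^esub> a) \<sqinter>\<^bsub>C\<^esub> compl C v = u \<sqinter>\<^bsub>C\<^esub> (a \<sqinter>\<^bsub>C\<^esub> compl C v)"
        using uv a c by (intro C.meet_assoc) auto
      ultimately show ?thesis using meet_comm[of C a "compl C v"] by simp
    qed
    have "(\<lambda>m\<in>carrier C. le C ?c m) \<in> points C"
      by (rule C.atom_point[OF cc nz]) (use below disj in blast)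
    moreover have "le C ?c a \<longleftrightarrow> x \<in> \<theta> a" if "a \<in> opens C" for a
    proof
      assume "le C ?c a"
      then have "?c = ?c \<sqinter>\<^bsub>C\<^esub> a" using C.le_iff_join[OF cc c(1)[OF that]] by simp
      then show "x \<in> \<theta> a" using disj[OF that] nz by (cases "x \<in> \<theta> a") simp_all
    qed (rule below[OF that])
    ultimately show ?thesis
      using c(1) by (intro bexI[of _ "\<lambda>m\<in>carrier C. le C ?c m"]) auto
  qed
  then obtain f where f: "\<And>x. x \<in> topspace X \<Longrightarrow> f x \<in> points C"
    "\<And>x a. x \<in> topspace X \<Longrightarrow> a \<in> opens C \<Longrightarrow> f x a \<longleftrightarrow> x \<in> \<theta> a" by metis
  have eq: "{x \<in> topspace X. f x a} = \<theta> a" if "a \<in> opens C" for a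
    using f(2)[OF _ that] sub[OF that] by auto
  have "(\<lambda>m\<in>carrier C. {x \<in> topspace X. f x m}) \<in> mt_hom C (powerset_mt X)"
    by (rule C.mt_hom_into_powerset) (use f(1) eq op in auto)
  then show ?thesis
    unfolding fiber_le_def prod.case using eq C.opens_carrier
    by (intro bexI[of _ "\<lambda>m\<in>carrier C. {x \<in> topspace X. f x m}"]) auto
qed

lemma powerset_fiber_terminal: "TD_space X \<Longrightarrow> fiber_terminal (powerset_mt X)"
  unfolding fiber_terminal_def using powerset_mt_algebra powerset_fiber_top by auto

section \<open>The locally closed completion of an MT-algebra\<close>

text \<open>An order isomorphism between frames of opens preserves the frame operations.\<close>

lemma (in mt_algebra) transport_frame_iso:
  assumes tr: "transport \<theta> (open_frame A) N"
  shows "\<theta> \<in> frame_iso (open_frame A) N"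
proof -
  have c: "carrier (open_frame A) = opens A" by (simp add: open_frame_def)
  have cN: "carrier N = \<theta> ` opens A" and inj: "inj_on \<theta> (opens A)"
    using tr by (simp_all add: transport_def c)
  have "\<theta> \<top>\<^bsub>open_frame A\<^esub> = \<top>\<^bsub>N\<^esub>"
    using transport_top[OF tr] open_frame_top c by metis
  moreover have "\<theta> (a \<sqinter>\<^bsub>open_frame A\<^esub> b) = \<theta> a \<sqinter>\<^bsub>N\<^esub> \<theta> b"
    if "a \<in> opens A" "b \<in> opens A" for a b
    using transport_inf[OF tr open_frame_glb] that c by (simp add: meet_def)
  moreover have "\<theta> (\<Squnion>\<^bsub>open_frame A\<^esub>S) = \<Squnion>\<^bsub>N\<^esub>(\<theta> ` S)" if "S \<subseteq> opens A" for S
    using transport_sup[OF tr open_frame_lub] that c by simp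
  ultimately show ?thesis
    using inj by (auto simp: frame_iso_def frame_hom_def c cN bij_betw_def)
qed

context mt_algebra
begin

text \<open>Differences of opens, the algebraic form of locally closed sets. Basic elements are more
  general, as they allow infinite meets of opens.\<close>

definition locally_closed :: "'a set"
  where "locally_closed = {a \<sqinter> compl A b | a b. a \<in> opens A \<and> b \<in> opens A}"

lemma locally_closed_carrier: "locally_closed \<subseteq> carrier A"
  using subsetD[OF opens_carrier] compl_props(1) meet_closed by (auto simp: locally_closed_def)

lemma locally_closed_meet:
  assumes "q \<in> locally_closed" "r \<in> locally_closed" shows "q \<sqinter> r \<in> locally_closed"
proof -
  obtain a b c d where o: "a \<in> opens A" "b \<in> opens A" "c \<in> opens A" "d \<in> opens A"
    and q: "q = a \<sqinter> compl A b" and r: "r = c \<sqinter> compl A d"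
    using assms by (auto simp: locally_closed_def)
  have car: "a \<in> carrier A" "b \<in> carrier A" "c \<in> carrier A" "d \<in> carrier A"
    using o opens_carrier by auto
  note cc = car compl_props(1)[OF car(2)] compl_props(1)[OF car(4)]
  have "q \<sqinter> r = a \<sqinter> (compl A b \<sqinter> (c \<sqinter> compl A d))"
    unfolding q r using cc by (simp add: meet_assoc)
  also have "compl A b \<sqinter> (c \<sqinter> compl A d) = (c \<sqinter> compl A d) \<sqinter> compl A b"
    by (rule meet_comm)
  also have "\<dots> = c \<sqinter> (compl A d \<sqinter> compl A b)"
    using cc by (simp add: meet_assoc)
  also have "compl A d \<sqinter> compl A b = compl A (d \<squnion> b)"
    using cc by (simp add: compl_join)
  also have "a \<sqinter> (c \<sqinter> compl A (d \<squnion> b)) = (a \<sqinter> c) \<sqinter> compl A (d \<squnion> b)"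
    using cc compl_props(1)[of "d \<squnion> b"] by (simp add: meet_assoc)
  finally have "q \<sqinter> r = (a \<sqinter> c) \<sqinter> compl A (d \<squnion> b)" .
  then show ?thesis
    unfolding locally_closed_def using open_meet[OF o(1,3)] open_join[OF o(4,2)] by blast
qed

lemma open_bottom: "\<bottom> \<in> opens A"
proof -
  have "\<Squnion>{} = \<bottom>" by (rule le_antisym) (auto intro: sup_least)
  then show ?thesis using open_Sup[of "{}"] by simp
qed

lemma compl_bottom: "compl A \<bottom> = \<top>"
proof (rule compl_eq)
  show "\<bottom> \<squnion> \<top> = \<top>" by (intro le_antisym join_le join_right join_closed) auto
  show "\<bottom> \<sqinter> \<top> = \<bottom>" by (intro le_antisym meet_left bottom_lower meet_closed) auto
qed simp_all

lemma open_locally_closed: "a \<in> opens A \<Longrightarrow> a \<in> locally_closed"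
proof -
  assume a: "a \<in> opens A"
  then have "a \<sqinter> \<top> = a" using opens_carrier by (intro le_antisym meet_le meet_left) auto
  then show ?thesis
    unfolding locally_closed_def using a open_bottom compl_bottom
    by (intro CollectI exI[of _ a] exI[of _ "\<bottom>"]) simp
qed

lemma compl_open_locally_closed: "a \<in> opens A \<Longrightarrow> compl A a \<in> locally_closed"
proof -
  assume a: "a \<in> opens A"
  then have "compl A a \<in> carrier A" using compl_props(1) opens_carrier by auto
  then have "\<top> \<sqinter> compl A a = compl A a" by (intro le_antisym meet_le meet_right) auto
  then show ?thesis 
    unfolding locally_closed_def using a open_top by (intro CollectI exI[of _ \<top>] exI[of _ a]) simp
qed

interpretation lc: semilattice_with_zero locally_closed "meet A" \<bottom>
proof
  fix x y z
  assume "x \<in> locally_closed"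
  then have x: "x \<in> carrier A" using locally_closed_carrier by auto
  show "x \<sqinter> y = y \<sqinter> x" by (rule meet_comm)
  show "x \<sqinter> x = x" using x by (simp add: meet_def)
  show "x \<sqinter> \<bottom> = \<bottom>" using x by (intro le_antisym meet_right meet_le) auto
  assume "y \<in> locally_closed"
  then have y: "y \<in> carrier A" using locally_closed_carrier by auto
  assume "z \<in> locally_closed"
  then have z: "z \<in> carrier A" using locally_closed_carrier by auto
  show "x \<sqinter> y \<sqinter> z = x \<sqinter> (y \<sqinter> z)" using x y z by (rule meet_assoc)
qed (use locally_closed_meet open_locally_closed[OF open_bottom] in simp_all)

text \<open>The principal ideal of locally closed elements generated by \<open>x\<close>, where \<open>x\<close> itself need not
  be locally closed.\<close>

definition below :: "'a \<Rightarrow> 'a set"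
  where "below x = {q \<in> locally_closed. q \<sqsubseteq> x}"

text \<open>The algebra of annihilator ideals of the locally closed elements; the opens are the principal
  ideals of opens.\<close>

definition completion :: "'a set mt"
  where "completion =
    \<lparr>carrier = semilattice_with_zero.annihilators locally_closed (meet A) \<bottom>,
      eq = (=), le = (\<subseteq>), opens = below ` opens A\<rparr>"

lemma completion_simps [simp]:
  "carrier completion = lc.annihilators" "eq completion = (=)"
  "le completion = (\<subseteq>)" "opens completion = below ` opens A"
  by (simp_all add: completion_def)

lemmas completion_Sup = lc.annihilators_Sup[of completion, simplified]
  and completion_meet = lc.annihilators_meet[of completion, simplified]
  and completion_compl = lc.annihilators_compl[of completion, simplified]
  and completion_top = lc.annihilators_top[of completion, simplified]

lemma below_subset: "below x \<subseteq> locally_closed"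
  by (auto simp: below_def)

lemma below_self: "q \<in> locally_closed \<Longrightarrow> q \<in> below q"
  using locally_closed_carrier by (auto simp: below_def)

lemma below_mono: "x \<in> carrier A \<Longrightarrow> y \<in> carrier A \<Longrightarrow> x \<sqsubseteq> y \<Longrightarrow> below x \<subseteq> below y"
  using locally_closed_carrier le_trans by (auto simp: below_def)

lemma below_meet:
  assumes x: "x \<in> carrier A" and y: "y \<in> carrier A" shows "below (x \<sqinter> y) = below x \<inter> below y"
  using below_mono[OF _ x meet_left[OF x y]] below_mono[OF _ y meet_right[OF x y]] x y
    locally_closed_carrier
  by (auto simp: below_def intro: meet_le)

text \<open>Complements of locally closed elements need not be locally closed, but their principal ideals
  still are annihilators.\<close>

lemma perp_below:
  assumes x: "x \<in> locally_closed" shows "lc.perp (below x) = below (compl A x)"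
proof -
  have xc: "x \<in> carrier A" using x locally_closed_carrier by auto
  have "(\<forall>s\<in>below x. q \<sqinter> s = \<bottom>) \<longleftrightarrow> q \<sqsubseteq> compl A x" if "q \<in> locally_closed" for q
  proof
    have qc: "q \<in> carrier A" using that locally_closed_carrier by auto
    show "q \<sqsubseteq> compl A x" if "\<forall>s\<in>below x. q \<sqinter> s = \<bottom>"
      using that below_self[OF x] disjoint_iff_le_compl[OF qc xc] by simp
    assume q: "q \<sqsubseteq> compl A x"
    show "\<forall>s\<in>below x. q \<sqinter> s = \<bottom>"
    proof
      fix s assume "s \<in> below x"
      then have s: "s \<in> carrier A" "s \<sqsubseteq> x" using locally_closed_carrier by (auto simp: below_def)
      have "q \<sqinter> s \<sqsubseteq> q \<sqinter> x"
        using qc xc s le_trans[OF meet_right[OF qc s(1)] s(2)] by (intro meet_le meet_left) auto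
      moreover have "q \<sqinter> x = \<bottom>" using q disjoint_iff_le_compl[OF qc xc] by simp
      ultimately show "q \<sqinter> s = \<bottom>" using qc s by (intro le_antisym) auto
    qed
  qed
  then show ?thesis by (auto simp: lc.perp_def below_def)
qed

lemma below_compl_annihilator:
  assumes a: "a \<in> opens A" shows "below (compl A a) \<in> lc.annihilators"
  using lc.perp_annihilator[OF below_subset, of a] perp_below[OF open_locally_closed[OF a]] by simp

lemma below_open_annihilator:
  assumes a: "a \<in> opens A" shows "below a \<in> lc.annihilators"
proof -
  have "a \<in> carrier A" using a opens_carrier by auto
  then show ?thesis
    using lc.perp_annihilator[OF below_subset, of "compl A a"]
      perp_below[OF compl_open_locally_closed[OF a]] compl_compl by simp
qed

lemma below_diff:
  assumes a: "a \<in> opens A" and b: "b \<in> opens A"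
  shows "below (a \<sqinter> compl A b) = below a \<sqinter>\<^bsub>completion\<^esub> compl completion (below b)"
proof -
  have c: "a \<in> carrier A" "b \<in> carrier A" using a b opens_carrier by auto
  have "compl completion (below b) = below (compl A b)"
    using completion_compl[OF below_open_annihilator[OF b]] perp_below[OF open_locally_closed[OF b]]
    by simp
  moreover have "below a \<sqinter>\<^bsub>completion\<^esub> below (compl A b) = below a \<inter> below (compl A b)"
    by (rule completion_meet[OF below_open_annihilator[OF a] below_compl_annihilator[OF b]])
  ultimately show ?thesis using below_meet[OF c(1) compl_props(1)[OF c(2)]] by simp
qed

lemma below_annihilator:
  assumes "q \<in> locally_closed" shows "below q \<in> lc.annihilators"
proof -
  obtain a b where ab: "a \<in> opens A" "b \<in> opens A" "q = a \<sqinter> compl A b"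
    using assms by (auto simp: locally_closed_def)
  have c: "a \<in> carrier A" "b \<in> carrier A" using ab opens_carrier by auto
  have "locally_closed \<inter> \<Inter>{below a, below (compl A b)} \<in> lc.annihilators"
    using ab(1,2) below_open_annihilator below_compl_annihilator
    by (intro lc.Inter_annihilators) auto
  moreover have "locally_closed \<inter> \<Inter>{below a, below (compl A b)} = below q"
    unfolding ab(3) below_meet[OF c(1) compl_props(1)[OF c(2)]] using below_subset by auto
  ultimately show ?thesis by simp
qed

text \<open>Joins of opens are preserved: an element disjoint from each member of \<open>S\<close> is disjoint from
  the join of \<open>S\<close>.\<close>

lemma below_Sup_opens:
  assumes S: "S \<subseteq> opens A" shows "below (\<Squnion>S) = \<Squnion>\<^bsub>completion\<^esub>(below ` S)"
proof -
  have Sc: "S \<subseteq> carrier A" using S opens_carrier by auto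
  have ann: "below ` S \<subseteq> lc.annihilators" using S below_open_annihilator by auto
  have "below (\<Squnion>S) \<subseteq> lc.perp (lc.perp (\<Union>(below ` S)))"
  proof
    fix q assume q: "q \<in> below (\<Squnion>S)"
    then have qc: "q \<in> locally_closed" "q \<in> carrier A" "q \<sqsubseteq> \<Squnion>S"
      using locally_closed_carrier by (auto simp: below_def)
    have "q \<sqinter> r = \<bottom>" if r: "r \<in> lc.perp (\<Union>(below ` S))" for r
    proof -
      have rc: "r \<in> carrier A" using r locally_closed_carrier by (auto simp: lc.perp_def)
      have "r \<sqinter> s = \<bottom>" if "s \<in> S" for s
        using r that S below_self[OF open_locally_closed] by (auto simp: lc.perp_def)
      then have z: "r \<sqinter> \<Squnion>S = \<bottom>" using disjoint_Sup_iff[OF rc Sc] by simp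
      have "r \<sqinter> q \<sqsubseteq> r \<sqinter> \<Squnion>S"
        using rc qc Sc le_trans[OF meet_right[OF rc qc(2)] qc(3)] by (intro meet_le meet_left) auto
      then have "r \<sqinter> q = \<bottom>" unfolding z using rc qc by (intro le_antisym) auto
      then show ?thesis using meet_comm[of A q r] by simp
    qed
    then show "q \<in> lc.perp (lc.perp (\<Union>(below ` S)))" using qc by (simp add: lc.perp_def)
  qed
  moreover have "lc.perp (lc.perp (\<Union>(below ` S))) \<subseteq> below (\<Squnion>S)"
  proof (rule lc.perp_perp_least[OF _ below_open_annihilator[OF open_Sup[OF S]]])
    have "below s \<subseteq> below (\<Squnion>S)" if "s \<in> S" for s
      using that Sc sup_upper[OF Sc that] by (intro below_mono) auto
    then show "\<Union>(below ` S) \<subseteq> below (\<Squnion>S)" by auto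
  qed
  ultimately show ?thesis unfolding completion_Sup[OF ann] by (rule antisym)
qed

text \<open>The principal ideals of locally closed elements are join-dense in the completion.\<close>

lemma annihilator_Sup_below:
  assumes x: "x \<in> lc.annihilators" shows "x = \<Squnion>\<^bsub>completion\<^esub>(below ` x)"
proof -
  have xs: "x \<subseteq> locally_closed" "lc.perp (lc.perp x) = x" using lc.annihilatorsD[OF x] by auto
  have "r \<in> x" if q: "q \<in> x" and r: "r \<in> below q" for q r
  proof -
    have rq: "r \<in> locally_closed" "r \<sqsubseteq> q" "q \<in> carrier A" "r \<in> carrier A"
      using r q xs locally_closed_carrier by (auto simp: below_def)
    have "r = q \<sqinter> r" using rq by (intro le_antisym meet_le meet_right) auto
    then show ?thesis using lc.annihilator_mult[OF x q rq(1)] by simp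
  qed
  moreover have "q \<in> below q" if "q \<in> x" for q using that below_self xs(1) by auto
  ultimately have "\<Union>(below ` x) = x" by auto
  moreover have "below ` x \<subseteq> lc.annihilators" using below_annihilator xs by auto
  ultimately show ?thesis using completion_Sup[of "below ` x"] xs by simp
qed

lemma completion_mt_algebra: "mt_algebra completion"
proof -
  interpret K: complete_boolean_lattice completion
    by (rule lc.annihilators_complete_boolean) simp_all
  show ?thesis
  proof unfold_locales
    show "subframe (opens completion) completion"
      unfolding subframe_def
    proof (intro conjI ballI allI impI)
      show "opens completion \<subseteq> carrier completion" using below_open_annihilator by auto
      have "q \<sqsubseteq> \<top>" if "q \<in> locally_closed" for q
        using that locally_closed_carrier top_higher by auto
      then have "below \<top> = locally_closed" by (auto simp: below_def)
      then show "\<top>\<^bsub>completion\<^esub> \<in> opens completion" using open_top completion_top by auto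
    next
      fix u v assume "u \<in> opens completion" "v \<in> opens completion"
      then obtain a b where ab: "a \<in> opens A" "b \<in> opens A" "u = below a" "v = below b" by auto
      have "u \<sqinter>\<^bsub>completion\<^esub> v = below (a \<sqinter> b)"
        unfolding ab(3,4) completion_meet[OF below_open_annihilator[OF ab(1)] below_open_annihilator[OF ab(2)]]
        using below_meet[of a b] ab(1,2) opens_carrier by auto
      then show "u \<sqinter>\<^bsub>completion\<^esub> v \<in> opens completion" using open_meet[OF ab(1,2)] by simp
    next
      fix S assume "S \<subseteq> opens completion"
      then obtain T where T: "T \<subseteq> opens A" "S = below ` T" by (auto elim: subset_imageE)
      then show "\<Squnion>\<^bsub>completion\<^esub>S \<in> opens completion"
        using below_Sup_opens[OF T(1)] open_Sup[OF T(1)] by auto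
    qed
  next
    fix x assume "x \<in> carrier completion"
    then have x: "x \<in> lc.annihilators" by simp
    have "below q \<in> basic_elements completion" if "q \<in> x" for q
    proof -
      have "q \<in> locally_closed" using that lc.annihilatorsD[OF x] by auto
      then obtain a b where ab: "a \<in> opens A" "b \<in> opens A" "q = a \<sqinter> compl A b"
        by (auto simp: locally_closed_def)
      have "below a \<in> carrier completion" using below_open_annihilator[OF ab(1)] by simp
      then have "\<Sqinter>\<^bsub>completion\<^esub>{below a} = below a" by (rule K.inf_of_singleton)
      then have "below q = \<Sqinter>\<^bsub>completion\<^esub>{below a} \<sqinter>\<^bsub>completion\<^esub> compl completion (below b)"
        using below_diff[OF ab(1,2)] ab(3) by simp
      then show ?thesis
        unfolding basic_elements_def using ab(1,2)
        by (intro CollectI exI[of _ "{below a}"] exI[of _ "below b"]) auto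
    qed
    then have "below ` x \<subseteq> basic_elements completion" by auto
    then show "\<exists>B\<subseteq>basic_elements completion. x = \<Squnion>\<^bsub>completion\<^esub>B"
      using annihilator_Sup_below[OF x] by (intro exI[of _ "below ` x"] conjI)
  qed
qed

lemma Sup_below:
  assumes q: "q \<in> locally_closed" shows "\<Squnion>(below q) = q"
proof -
  have c: "q \<in> carrier A" "below q \<subseteq> carrier A"
    using q below_subset locally_closed_carrier by auto
  show ?thesis
  proof (rule le_antisym)
    show "\<Squnion>(below q) \<sqsubseteq> q" using c by (intro sup_least) (auto simp: below_def)
    show "q \<sqsubseteq> \<Squnion>(below q)" using below_self[OF q] c by (intro sup_upper)
  qed (use c in simp_all)
qed

text \<open>The inverse of the embedding \<open>below\<close> of the opens takes an ideal to its join in \<open>A\<close>.\<close>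

lemma completion_fiber: "(completion, \<lambda>S. \<Squnion>S) \<in> fiber (open_frame A)"
proof -
  interpret K: mt_algebra completion by (rule completion_mt_algebra)
  have sup: "\<Squnion>(below a) = a" if "a \<in> opens A" for a
    using that by (rule Sup_below[OF open_locally_closed])
  have le: "below a \<subseteq> below b \<longleftrightarrow> a \<sqsubseteq> b" if "a \<in> opens A" "b \<in> opens A" for a b
  proof
    assume "below a \<subseteq> below b"
    then have "a \<in> below b" using below_self[OF open_locally_closed] that by auto
    then show "a \<sqsubseteq> b" by (simp add: below_def)
  qed (rule below_mono[OF subsetD[OF opens_carrier that(1)] subsetD[OF opens_carrier that(2)]])
  have "transport (\<lambda>S. \<Squnion>S) (open_frame completion) (open_frame A)"
    unfolding transport_def
  proof (intro conjI ballI)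
    show "partial_order (open_frame completion)" by (rule K.open_frame_partial_order)
    show "inj_on (\<lambda>S. \<Squnion>S) (carrier (open_frame completion))"
      by (rule inj_onI) (auto simp: open_frame_def sup)
    show "carrier (open_frame A) = (\<lambda>S. \<Squnion>S) ` carrier (open_frame completion)"
      by (simp add: open_frame_def image_image sup)
    show "eq (open_frame A) = (=)" by (simp add: open_frame_def)
    fix x y assume "x \<in> carrier (open_frame completion)" "y \<in> carrier (open_frame completion)"
    then obtain a b where "a \<in> opens A" "b \<in> opens A" "x = below a" "y = below b"
      by (auto simp: open_frame_def)
    then show "le (open_frame A) (\<Squnion>x) (\<Squnion>y) \<longleftrightarrow> le (open_frame completion) x y"
      by (simp add: open_frame_def sup le)
  qed
  then show ?thesis
    using K.transport_frame_iso K.mt_algebra_axioms by (simp add: fiber_def)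
qed

text \<open>Every point of the completion is represented by a locally closed element. The least element
  \<open>t\<close> on which the point is true is a join of principal ideals of locally closed elements, so the
  point is true on one of these, which lies below \<open>t\<close> and hence equals it.\<close>

lemma completion_point:
  assumes h: "h \<in> points completion"
  shows "\<exists>a\<in>opens A. \<exists>b\<in>opens A. \<forall>x\<in>carrier completion. h x \<longleftrightarrow>
    below a \<sqinter>\<^bsub>completion\<^esub> compl completion (below b) \<subseteq> x"
proof -
  interpret K: mt_algebra completion by (rule completion_mt_algebra)
  let ?F = "{x \<in> carrier completion. h x}"
  define t where "t = \<Sqinter>\<^bsub>completion\<^esub>?F"
  have sub: "?F \<subseteq> carrier completion" by auto
  have ht: "h t" unfolding t_def using K.points_Inf[OF h sub] by simp
  have tc: "t \<in> carrier completion" unfolding t_def by (rule K.inf_closed[OF sub])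
  have tle: "t \<subseteq> x" if "x \<in> carrier completion" "h x" for x
    using K.inf_lower[OF sub, of x] that by (simp add: t_def)
  have ts: "t \<subseteq> locally_closed" using tc lc.annihilatorsD by auto
  then have bs: "below ` t \<subseteq> carrier completion" using below_annihilator by auto
  have "h (\<Squnion>\<^bsub>completion\<^esub>(below ` t))" using ht annihilator_Sup_below[of t] tc by simp
  then obtain q where q: "q \<in> t" "h (below q)" using K.points_Sup[OF h bs] by auto
  then obtain a b where ab: "a \<in> opens A" "b \<in> opens A" "q = a \<sqinter> compl A b"
    using ts by (auto simp: locally_closed_def)
  have qc: "below q \<in> carrier completion" using bs q by auto
  have "h x \<longleftrightarrow> below q \<subseteq> x" if x: "x \<in> carrier completion" for x
  proof
    assume "h x"
    then have "q \<in> x" using tle[OF x] q by auto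
    then show "below q \<subseteq> x"
      using annihilator_Sup_below[of x] x K.sup_upper[of "below ` x" "below q"]
        lc.annihilatorsD[of x] below_annihilator by (auto simp: subset_iff)
  next
    assume "below q \<subseteq> x"
    then show "h x" using K.points_mono[OF h qc x] q by simp
  qed
  then show ?thesis using ab below_diff[OF ab(1,2)] by metis
qed

end


section \<open>Spectra of fiber-terminal algebras are \<open>T\<^sub>D\<close>\<close>

lemma fiber_terminal_spectrum_TD:
  assumes A: "fiber_terminal A" shows "TD_space (spectrum A)"
proof -
  interpret A: mt_algebra A using A by (simp add: fiber_terminal_def)
  interpret C: mt_algebra A.completion by (rule A.completion_mt_algebra)
  obtain p where p: "p \<in> mt_hom A.completion A"
    and p_below: "\<And>a. a \<in> opens A \<Longrightarrow> p (A.below a) = a"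
  proof -
    have "fiber_le (A.completion, \<lambda>S. \<Squnion>\<^bsub>A\<^esub>S) (A, id)"
      by (rule fiber_terminal_universal[OF A A.completion_fiber])
    then show ?thesis
      using that A.Sup_below[OF A.open_locally_closed] by (auto simp: fiber_le_def)
  qed
  have lift: "restrict (f \<circ> p) (carrier A.completion) \<in> points A.completion" if "f \<in> points A" for f
    by (rule points_comp[OF C.mt_algebra_axioms A.mt_algebra_axioms p that])
  have val: "f a \<longleftrightarrow> restrict (f \<circ> p) (carrier A.completion) (A.below a)" if "a \<in> opens A" for f a
    using that p_below[OF that] A.below_open_annihilator[OF that] by simp
  have "\<exists>U V. openin (spectrum A) U \<and> openin (spectrum A) V \<and> {f} = U - V"
    if f: "f \<in> points A" for f
  proof -
    let ?h = "\<lambda>g. restrict (g \<circ> p) (carrier A.completion)"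
    obtain a b where ab: "a \<in> opens A" "b \<in> opens A"
      and h: "\<And>x. x \<in> carrier A.completion \<Longrightarrow> ?h f x \<longleftrightarrow>
        A.below a \<sqinter>\<^bsub>A.completion\<^esub> compl A.completion (A.below b) \<subseteq> x"
      using A.completion_point[OF lift[OF f]] by blast
    let ?t = "A.below a \<sqinter>\<^bsub>A.completion\<^esub> compl A.completion (A.below b)"
    have c: "A.below a \<in> carrier A.completion" "A.below b \<in> carrier A.completion"
      using ab A.below_open_annihilator by simp_all
    have tc: "?t \<in> carrier A.completion" by (rule C.meet_closed[OF c(1) C.compl_props(1)[OF c(2)]])
    have at: "?h g ?t \<longleftrightarrow> g a \<and> \<not> g b" if "g \<in> points A" for g
      using C.points_meet[OF lift[OF that] c(1) C.compl_props(1)[OF c(2)]]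
        C.points_compl[OF lift[OF that] c(2)] val[OF ab(1), of g] val[OF ab(2), of g] by simp
    have "g = f" if g: "g \<in> points A" "g a" "\<not> g b" for g
    proof (rule A.points_eqI[OF g(1) f])
      fix u assume u: "u \<in> opens A"
      then have uc: "A.below u \<in> carrier A.completion" using A.below_open_annihilator by simp
      have gt: "?h g ?t" using at[OF g(1)] g by simp
      \<comment> \<open>A Boolean homomorphism that is true wherever another one is true coincides with it.\<close>
      have imp: "?h g x" if "x \<in> carrier A.completion" "?h f x" for x
      proof (rule C.points_mono[OF lift[OF g(1)] tc that(1) _ gt])
        show "le A.completion ?t x"
          unfolding A.completion_simps(3) by (rule iffD1[OF h[OF that(1)] that(2)])
      qed
      have "?h f (A.below u) \<longleftrightarrow> ?h g (A.below u)"
        using imp[OF uc] imp[OF C.compl_props(1)[OF uc]] C.points_compl[OF lift[OF f] uc]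
          C.points_compl[OF lift[OF g(1)] uc] by argo
      then show "g u \<longleftrightarrow> f u" unfolding val[OF u] by (rule sym)
    qed
    then have uniq: "g = f" if "g \<in> {g \<in> points A. g a} - {g \<in> points A. g b}" for g
      using that by simp
    have "f a \<and> \<not> f b" using h[OF tc] unfolding at[OF f] by simp
    then have "f \<in> {g \<in> points A. g a} - {g \<in> points A. g b}" using f by simp
    then have "{f} = {g \<in> points A. g a} - {g \<in> points A. g b}"
      by (intro equalityI subsetI) (simp, simp add: uniq)
    moreover have "openin (spectrum A) {g \<in> points A. g u}" if "u \<in> opens A" for u
      unfolding openin_spectrum[OF A.mt_algebra_axioms] by (rule bexI[of _ u]) (simp_all add: that)
    ultimately show ?thesis using ab by (intro exI conjI)
  qed
  then show ?thesis
    unfolding TD_space_iff topspace_spectrum[OF A.mt_algebra_axioms] by blast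
qed

lemma homeomorphic_TD_space:
  assumes hom: "X homeomorphic_space Y" and TD: "TD_space Y" shows "TD_space X"
  unfolding TD_space_iff
proof
  obtain f where f: "homeomorphic_map X Y f"
    using hom unfolding homeomorphic_space by blast
  then have cont: "continuous_map X Y f" and inj: "inj_on f (topspace X)"
    and img: "f ` topspace X = topspace Y"
    using homeomorphic_imp_continuous_map homeomorphic_imp_injective_map
      homeomorphic_imp_surjective_map by blast+
  fix x assume x: "x \<in> topspace X"
  then have "f x \<in> topspace Y" using img by blast
  then obtain U V where UV: "openin Y U" "openin Y V" "{f x} = U - V"
    using TD unfolding TD_space_iff by blast
  have uniq: "y = x" if "y \<in> topspace X" "f y \<in> U" "f y \<notin> V" for y
  proof -
    have "f y = f x" using UV(3) that by blast
    then show ?thesis using inj x that(1) by (simp add: inj_on_eq_iff)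
  qed
  have fx: "f x \<in> U" "f x \<notin> V" using UV(3) by auto
  have "{x} = {y \<in> topspace X. f y \<in> U} - {y \<in> topspace X. f y \<in> V}"
    by (intro equalityI subsetI) (simp add: x fx, simp add: uniq)
  then show "\<exists>U V. openin X U \<and> openin X V \<and> {x} = U - V"
    using openin_continuous_map_preimage[OF cont UV(1)]
      openin_continuous_map_preimage[OF cont UV(2)] by blast
qed

theorem proposition3p36:
  fixes X :: "'a topology"
  shows "(TD_space X \<longleftrightarrow>
           (\<exists>A :: 'a set mt. fiber_terminal A \<and> X homeomorphic_space spectrum A)) \<and>
         (\<forall>A :: 'b mt. fiber_terminal A \<and> X homeomorphic_space spectrum A \<longrightarrow> TD_space X)"
proof (intro conjI iffI allI impI)
  assume X: "TD_space X"
  show "\<exists>A :: 'a set mt. fiber_terminal A \<and> X homeomorphic_space spectrum A"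
    using powerset_fiber_terminal[OF X]
      homeomorphic_spectrum_powerset[OF powerset_mt_algebra[OF X]] by blast
qed (use homeomorphic_TD_space fiber_terminal_spectrum_TD in blast)+

end
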